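(* Let $G\in\mathrm{Mat}_{k\times n}(\mathbb{Z})$ have no zero column, with lcm period $\rho_0$, and let $m\in\{1,\dots,\rho_0\}$ be a divisor of $\rho_0$. Then $d_q=d'_m$ for every $q\in\mathbb{Z}_{>0}$ with $q>m$ and $\gcd(q,\rho_0)=m$. Furthermore, $d_m=d'_m$ holds if and only if there exists $J\subseteq E$ with $|J|=n-d'_m$ such that either (i) $\displaystyle\frac{\prod_{\ell=1}^{r(J)}\gcd(m,e_{\ell,J})}{\prod_{\ell=1}^{r(J)}\gcd(m,e_{\ell,E})}\ne1$, or (ii) $r(E)=r(J)+1$ and $m\nmid e_{r(J)+1,E}$.
   Context: $\mathbb{Z}_q:=\mathbb{Z}/q\mathbb{Z}$; $E=\{1,\dots,n\}$; $C_G(q):=\{uG\mid u\in\mathbb{Z}_q^k\}$; $d_q$ is the minimum weight of $C_G(q)$, i.e. the minimum number of nonzero entries of a nonzero codeword ($+\infty$ if $C_G(q)=\{0\}$). For nonempty $J\subseteq E$, $r(J)$ is the rank of the submatrix $G_J$ of columns indexed by $J$ and $e_{1,J}\mid\cdots\mid e_{r(J),J}$ its elementary divisors; $r(\emptyset)=0$; empty products equal $1$. $\rho_0:=\mathrm{lcm}(e_{r(J),J}\mid\emptyset\ne J\subseteq E)$. For $m\in\{1,\dots,\rho_0\}$ and $i\in\{0,\dots,n\}$, $$f_i^m(t):=\sum_{J\subseteq E,\ |J|=n-i}\ \sum_{K:\,J\subseteq K\subseteq E}(-1)^{|K|-|J|}\frac{\prod_{\ell=1}^{r(K)}\gcd(m,e_{\ell,K})}{\prod_{\ell=1}^{r(E)}\gcd(m,e_{\ell,E})}\,t^{r(E)-r(K)}\in\mathbb{Q}[t],$$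 and $d'_m:=\min\{i\in\mathbb{Z}_{>0}\mid f_i^m(t)\ne0\text{ as a polynomial}\}$. *)

theory Defs
  imports
    "Jordan_Normal_Form.DL_Rank"
    "Jordan_Normal_Form.DL_Submatrix"
    "HOL-Library.Extended_Nat"
    "HOL-Computational_Algebra.Polynomial"
begin

section \<open>Codes over the integers modulo q\<close>

text \<open>
  The ring of integers modulo q is represented by the residues in \<open>{0..<q}\<close>, so a vector over it
  is an integer vector with entries in that interval. The case q = 1, where the only codeword
  is zero, is included.
\<close>

definition zmod_vecs :: "nat \<Rightarrow> nat \<Rightarrow> int vec set" where
  "zmod_vecs q k = {u \<in> carrier_vec k. \<forall>i<k. u $ i \<in> {0..<int q}}"

definition code :: "int mat \<Rightarrow> nat \<Rightarrow> int vec set" where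
  "code G q =
     (\<lambda>u. map_vec (\<lambda>x. x mod int q) (transpose_mat G *\<^sub>v u)) ` zmod_vecs q (dim_row G)"

definition weight :: "int vec \<Rightarrow> nat" where
  "weight c = card {j. j < dim_vec c \<and> c $ j \<noteq> 0}"

text \<open>The infimum in \<^typ>\<open>enat\<close> of the empty set is \<open>\<infinity>\<close>.\<close>

definition min_weight :: "int mat \<Rightarrow> nat \<Rightarrow> enat" where
  "min_weight G q = Inf {enat (weight c) | c. c \<in> code G q \<and> c \<noteq> 0\<^sub>v (dim_col G)}"

section \<open>Rank and elementary divisors\<close>

definition int_rank :: "int mat \<Rightarrow> nat" where
  "int_rank A = vec_space.rank (dim_row A) (map_mat rat_of_int A)"

definition smith_diag :: "nat \<Rightarrow> nat \<Rightarrow> nat list \<Rightarrow> int mat" where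
  "smith_diag nr nc es =
     mat nr nc (\<lambda>(i, j). if i = j \<and> i < length es then int (es ! i) else 0)"

definition is_elementary_divisors :: "int mat \<Rightarrow> nat list \<Rightarrow> bool" where
  "is_elementary_divisors A es \<longleftrightarrow>
     length es = int_rank A \<and> (\<forall>e \<in> set es. 0 < e) \<and> sorted_wrt (dvd) es \<and>
     (\<exists>P Q. P \<in> carrier_mat (dim_row A) (dim_row A) \<and> invertible_mat P \<and>
            Q \<in> carrier_mat (dim_col A) (dim_col A) \<and> invertible_mat Q \<and>
            P * A * Q = smith_diag (dim_row A) (dim_col A) es)"

text \<open>Such a list exists and is unique for every integer matrix (Smith normal form).\<close>

definition elementary_divisors :: "int mat \<Rightarrow> nat list" where
  "elementary_divisors A = (SOME es. is_elementary_divisors A es)"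

text \<open>
  Columns are numbered from 0, so the ground set is \<open>{0..<n}\<close>; the elementary divisors
  are numbered from 1.
\<close>

definition ground :: "int mat \<Rightarrow> nat set" where
  "ground G = {0..<dim_col G}"

definition col_rank :: "int mat \<Rightarrow> nat set \<Rightarrow> nat" where
  "col_rank G J = int_rank (submatrix G UNIV J)"

definition elem_div :: "int mat \<Rightarrow> nat set \<Rightarrow> nat \<Rightarrow> nat" where
  "elem_div G J l = elementary_divisors (submatrix G UNIV J) ! (l - 1)"

definition lcm_period :: "int mat \<Rightarrow> nat" where
  "lcm_period G = Lcm ((\<lambda>J. elem_div G J (col_rank G J)) ` {J. J \<noteq> {} \<and> J \<subseteq> ground G})"

section \<open>The weight polynomials\<close>

definition weight_poly :: "int mat \<Rightarrow> nat \<Rightarrow> nat \<Rightarrow> rat poly" where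
  "weight_poly G m i =
     (\<Sum>J \<in> {J. J \<subseteq> ground G \<and> card J = dim_col G - i}.
        \<Sum>K \<in> {K. J \<subseteq> K \<and> K \<subseteq> ground G}.
          monom
            ((-1) ^ (card K - card J) *
              (of_nat (\<Prod>l = 1..col_rank G K. gcd m (elem_div G K l)) /
               of_nat (\<Prod>l = 1..col_rank G (ground G). gcd m (elem_div G (ground G) l))))
            (col_rank G (ground G) - col_rank G K))"

text \<open>
  If no column of G is zero and there is at least one column, then the index \<open>dim_col G\<close> qualifies
  (its polynomial has a nonzero coefficient in degree the rank of G), so the minimum exists.
\<close>

definition poly_min_weight :: "int mat \<Rightarrow> nat \<Rightarrow> nat" where
  "poly_min_weight G m = (LEAST i. 0 < i \<and> i \<le> dim_col G \<and> weight_poly G m i \<noteq> 0)"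

end

theory Submission
  imports Defs
begin

text \<open>
  For a set K of columns, the Smith normal form of \<open>G\<^sub>K\<close> counts the codewords modulo q vanishing on K:
  their number is \<open>c\<^sub>K q^(r(E) - r(K))\<close>, where the ratio \<open>c\<^sub>K\<close> of gcd products depends only on
  \<open>m = gcd(q, \<rho>\<^sub>0)\<close>. By inclusion-exclusion a polynomial \<open>g\<^sub>J\<close> counts the codewords whose zero set is
  exactly J, and the weight polynomial of index i is the sum of the \<open>g\<^sub>J\<close> with \<open>|J| = n - i\<close>. Since all
  values at the infinitely many q with \<open>gcd(q, \<rho>\<^sub>0) = m\<close> are nonnegative, minimality of \<open>d = d'\<^sub>m\<close> forces
  \<open>g\<^sub>K = 0\<close> for \<open>n - d < |K| < n\<close>. Hence \<open>g\<^sub>J = c\<^sub>J t^s - 1\<close> with \<open>s = r(E) - r(J)\<close> whenever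
  \<open>|J| = n - d\<close>. Its value at m is nonnegative and it is increasing if \<open>s > 0\<close>, so
  a nonzero \<open>g\<^sub>J\<close> is positive at every admissible \<open>q > m\<close>. At \<open>q = m\<close> one has \<open>s \<le> 1\<close> and \<open>c\<^sub>J m^s\<close> is a
  product of two factors, both at least 1 because the elementary divisors of G divide those of \<open>G\<^sub>J\<close>;
  conditions (i) and (ii) say that one of these factors differs from 1.
\<close>

section \<open>Smith normal form over the integers\<close>

text \<open>\<open>elementary_divisors\<close> is a choice, and all that is known about its value is
  that it is a Smith form, so the facts below are proved for arbitrary lists satisfying
  \<open>smith_form\<close>. The classical way to compare the divisors of G with those of a column
  submatrix uses gcds of minors. Here a single primitive integer vector does this work, and its
  existence only rests on the solvability of a homogeneous system with fewer equations than
  unknowns. The same solvability over the rationals ties the length of the list to the rank.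

  The Smith form counts messages u rather than codewords. Every codeword comes from equally many
  messages, and dividing by this multiplicity puts the gcd product of E into the denominator and
  turns the exponent k - r(K) into r(E) - r(K).

  The modulus m is itself admissible and is the smallest one. A nonzero \<open>g\<^sub>J\<close> may
  still have a root there, which is why m is excluded from the first claim and needs a criterion of
  its own.\<close>

definition inverse_pair :: "nat \<Rightarrow> int mat \<Rightarrow> int mat \<Rightarrow> bool" where
  "inverse_pair n P P' \<longleftrightarrow> P \<in> carrier_mat n n \<and> P' \<in> carrier_mat n n \<and> P * P' = 1\<^sub>m n \<and> P' * P = 1\<^sub>m n"

lemma invertible_mat_iff_inverse_pair:
  assumes "P \<in> carrier_mat n n"
  shows "invertible_mat P \<longleftrightarrow> (\<exists>P'. inverse_pair n P P')"
proof
  assume "invertible_mat P"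
  then obtain B where B: "P * B = 1\<^sub>m (dim_row P)" "B * P = 1\<^sub>m (dim_row B)"
    unfolding invertible_mat_def inverts_mat_def by blast
  have "dim_row B = n" using arg_cong[OF B(2), of dim_col] assms by auto
  moreover have "dim_col B = n" using arg_cong[OF B(1), of dim_col] assms by auto
  ultimately show "\<exists>P'. inverse_pair n P P'"
    using B assms unfolding inverse_pair_def by (intro exI[of _ B]) auto
next
  assume "\<exists>P'. inverse_pair n P P'"
  then obtain P' where "inverse_pair n P P'" ..
  then show "invertible_mat P"
    unfolding invertible_mat_def inverts_mat_def inverse_pair_def
    by (intro conjI exI[of _ P']) auto
qed

lemma inverse_pair_sym: "inverse_pair n P P' \<Longrightarrow> inverse_pair n P' P"
  unfolding inverse_pair_def by blast

lemma inverse_pair_one: "inverse_pair n (1\<^sub>m n) (1\<^sub>m n)"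
  unfolding inverse_pair_def by simp

lemma inverse_pair_mult:
  assumes "inverse_pair n P P'" "inverse_pair n R R'"
  shows "inverse_pair n (P * R) (R' * P')"
proof -
  have [simp]: "P \<in> carrier_mat n n" "P' \<in> carrier_mat n n" "R \<in> carrier_mat n n" "R' \<in> carrier_mat n n"
    using assms unfolding inverse_pair_def by auto
  have [simp]: "P * R \<in> carrier_mat n n" "R' * P' \<in> carrier_mat n n"
    by (auto intro!: mult_carrier_mat[of _ n n])
  have "(P * R) * (R' * P') = P * (R * R') * P'"
    using assoc_mult_mat[of "P * R" n n R' n P' n] assoc_mult_mat[of P n n R n R' n] by simp
  moreover have "(R' * P') * (P * R) = R' * (P' * P) * R"
    using assoc_mult_mat[of "R' * P'" n n P n R n] assoc_mult_mat[of R' n n P' n P n] by simp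
  ultimately show ?thesis
    using assms right_mult_one_mat[of P n n] right_mult_one_mat[of R' n n]
    unfolding inverse_pair_def by simp
qed

text \<open>Unimodular equivalence: over the integers the invertible matrices are those of
  determinant 1 or -1.\<close>

definition smith_equiv :: "nat \<Rightarrow> nat \<Rightarrow> int mat \<Rightarrow> int mat \<Rightarrow> bool" where
  "smith_equiv nr nc A B \<longleftrightarrow> A \<in> carrier_mat nr nc \<and>
     (\<exists>P P' Q Q'. inverse_pair nr P P' \<and> inverse_pair nc Q Q' \<and> B = P * A * Q)"

lemma smith_equiv_carrier:
  assumes "smith_equiv nr nc A B"
  shows "A \<in> carrier_mat nr nc" "B \<in> carrier_mat nr nc"
  using assms unfolding smith_equiv_def inverse_pair_def
  by (auto intro!: mult_carrier_mat)

lemma smith_equivI: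
  assumes "A \<in> carrier_mat nr nc" "inverse_pair nr P P'" "inverse_pair nc Q Q'" "B = P * A * Q"
  shows "smith_equiv nr nc A B"
  using assms unfolding smith_equiv_def by blast

lemma smith_equiv_refl: "A \<in> carrier_mat nr nc \<Longrightarrow> smith_equiv nr nc A A"
  by (rule smith_equivI[OF _ inverse_pair_one inverse_pair_one]) auto

lemma smith_equiv_left:
  assumes "A \<in> carrier_mat nr nc" "inverse_pair nr P P'"
  shows "smith_equiv nr nc A (P * A)"
proof -
  have "P * A \<in> carrier_mat nr nc"
    using assms unfolding inverse_pair_def by (auto intro: mult_carrier_mat)
  then show ?thesis
    by (intro smith_equivI[OF assms inverse_pair_one]) (use right_mult_one_mat[of "P * A" nr nc] in simp)
qed

lemma smith_equiv_right:
  assumes "A \<in> carrier_mat nr nc" "inverse_pair nc Q Q'"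
  shows "smith_equiv nr nc A (A * Q)"
  by (intro smith_equivI[OF assms(1) inverse_pair_one assms(2)]) (use assms in simp)

lemma smith_equiv_trans [trans]:
  assumes "smith_equiv nr nc A B" "smith_equiv nr nc B C"
  shows "smith_equiv nr nc A C"
proof -
  obtain P P' Q Q' where 1: "inverse_pair nr P P'" "inverse_pair nc Q Q'" "B = P * A * Q"
    using assms(1) unfolding smith_equiv_def by auto
  obtain R R' S S' where 2: "inverse_pair nr R R'" "inverse_pair nc S S'" "C = R * B * S"
    using assms(2) unfolding smith_equiv_def by auto
  have A [simp]: "A \<in> carrier_mat nr nc" using assms(1) smith_equiv_carrier by blast
  have [simp]: "P \<in> carrier_mat nr nr" "R \<in> carrier_mat nr nr" "Q \<in> carrier_mat nc nc" "S \<in> carrier_mat nc nc"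
    using 1 2 unfolding inverse_pair_def by auto
  have [simp]: "P * A \<in> carrier_mat nr nc" "A * Q \<in> carrier_mat nr nc"  
    "R * (P * A) \<in> carrier_mat nr nc"
    using mult_carrier_mat[of P nr nr A nc] mult_carrier_mat[of A nr nc Q nc]
      mult_carrier_mat[of R nr nr "P * A" nc] by simp_all
  have "C = R * (P * A * Q) * S" using 1 2 by simp
  also have "\<dots> = R * (P * A) * Q * S" by (subst assoc_mult_mat[of R nr nr "P * A" nc Q nc]) auto
  also have "\<dots> = R * (P * A) * (Q * S)" by (subst assoc_mult_mat[of _ nr nc Q nc S nc]) auto
  also have "\<dots> = (R * P) * A * (Q * S)" by (subst assoc_mult_mat[of R nr nr P nr A nc]) auto
  finally show ?thesis
    using smith_equivI[OF A inverse_pair_mult[OF 2(1) 1(1)] inverse_pair_mult[OF 1(2) 2(2)]] by blast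
qed

lemma smith_equiv_sym:
  assumes "smith_equiv nr nc A B"
  shows "smith_equiv nr nc B A"
proof -
  obtain P P' Q Q' where 1: "inverse_pair nr P P'" "inverse_pair nc Q Q'" "B = P * A * Q"
    using assms unfolding smith_equiv_def by auto
  have A [simp]: "A \<in> carrier_mat nr nc" using assms(1) smith_equiv_carrier by blast
  have [simp]: "P \<in> carrier_mat nr nr" "P' \<in> carrier_mat nr nr" "Q \<in> carrier_mat nc nc" "Q' \<in> carrier_mat nc nc"
    using 1 unfolding inverse_pair_def by auto
  have [simp]: "P * A \<in> carrier_mat nr nc" "A * Q \<in> carrier_mat nr nc" "P' * P \<in> carrier_mat nr nr"
    using mult_carrier_mat[of P' nr nr P nr] mult_carrier_mat[of P nr nr A nc] mult_carrier_mat[of A nr nc Q nc] by simp_all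
  have "P' * B * Q' = P' * (P * (A * Q)) * Q'"
    unfolding 1 by (subst assoc_mult_mat[of P nr nr A nc Q nc]) auto
  also have "\<dots> = (P' * P) * (A * Q) * Q'" by (subst assoc_mult_mat[of P' nr nr P nr _ nc]) auto
  also have "\<dots> = (P' * P) * (A * (Q * Q'))"
  proof (subst assoc_mult_mat[of "P' * P" nr nr _ nc Q' nc])
    show "P' * P * (A * Q * Q') = P' * P * (A * (Q * Q'))"
      by (subst assoc_mult_mat[of A nr nc Q nc Q' nc]) auto
  qed auto
  also have "\<dots> = A"
    using 1 right_mult_one_mat[OF A] left_mult_one_mat[OF A] unfolding inverse_pair_def by simp
  finally show ?thesis
    using smith_equivI[OF _ inverse_pair_sym[OF 1(1)] inverse_pair_sym[OF 1(2)]]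
      smith_equiv_carrier(2)[OF assms] by metis
qed

section \<open>Elementary operations and other instances of unimodular equivalence\<close>

lemma smith_equiv_addrow:
  assumes "A \<in> carrier_mat nr nc" "k < nr" "l < nr" "k \<noteq> l"
  shows "smith_equiv nr nc A (addrow a k l A)"
proof -
  have "inverse_pair nr (addrow_mat nr a k l) (addrow_mat nr (-a) k l)"
    using addrow_mat_inv[OF assms(2-4), of a] addrow_mat_inv[OF assms(2-4), of "-a"]
    unfolding inverse_pair_def by simp
  from smith_equiv_left[OF assms(1) this] show ?thesis using addrow_mat[OF assms(1,3)] by simp
qed

lemma smith_equiv_addcol:
  assumes "A \<in> carrier_mat nr nc" "k < nc" "l < nc" "k \<noteq> l"
  shows "smith_equiv nr nc A (addcol a k l A)"
proof -
  have "inverse_pair nc (addrow_mat nc a l k) (addrow_mat nc (-a) l k)"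
    using addrow_mat_inv[OF assms(3,2) assms(4)[symmetric], of a]
      addrow_mat_inv[OF assms(3,2) assms(4)[symmetric], of "-a"]
    unfolding inverse_pair_def by simp
  from smith_equiv_right[OF assms(1) this] show ?thesis using addcol_mat[OF assms(1,3)] by simp
qed

lemma smith_equiv_swaprows:
  assumes "A \<in> carrier_mat nr nc" "k < nr" "l < nr"
  shows "smith_equiv nr nc A (swaprows k l A)"
proof -
  have "inverse_pair nr (swaprows_mat nr k l) (swaprows_mat nr k l)"
    using swaprows_mat_inv[OF assms(2,3)] unfolding inverse_pair_def by simp
  from smith_equiv_left[OF assms(1) this] show ?thesis using swaprows_mat[OF assms] by simp
qed

lemma smith_equiv_swapcols:
  assumes "A \<in> carrier_mat nr nc" "k < nc" "l < nc"
  shows "smith_equiv nr nc A (swapcols k l A)"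
proof -
  have "inverse_pair nc (swaprows_mat nc k l) (swaprows_mat nc k l)"
    using swaprows_mat_inv[OF assms(2,3)] unfolding inverse_pair_def by simp
  from smith_equiv_right[OF assms(1) this] show ?thesis using swapcols_mat[OF assms] by simp
qed

lemma smith_equiv_uminus:
  assumes "A \<in> carrier_mat nr nc"
  shows "smith_equiv nr nc A (- A)"
proof -
  have "inverse_pair nr (- 1\<^sub>m nr) (- 1\<^sub>m nr)"
    unfolding inverse_pair_def by (auto simp: uminus_mult_left_mat)
  moreover have "- 1\<^sub>m nr * A = - A" using assms by (simp add: uminus_mult_left_mat)
  ultimately show ?thesis using smith_equiv_left[OF assms] by metis
qed

lemma dvd_mult_mat_entries:
  fixes A B :: "int mat"
  assumes "A \<in> carrier_mat nr n" "B \<in> carrier_mat n nc" "i < nr" "j < nc"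
    and "(\<forall>l<n. d dvd A $$ (i,l)) \<or> (\<forall>l<n. d dvd B $$ (l,j))"
  shows "d dvd (A * B) $$ (i,j)"
  using assms by (auto simp: scalar_prod_def intro!: dvd_sum)

text \<open>The entries of \<open>P * A * Q\<close> are integer combinations of those of
  \<open>A\<close>. This carries divisibility by a pivot over to the diagonal form of the remaining
  block; with \<open>d = 0\<close> it shows that only a zero matrix is equivalent to zero.\<close>

lemma smith_equiv_dvd_entries:
  assumes eq: "smith_equiv nr nc A B"
    and dvd: "\<And>i j. i < nr \<Longrightarrow> j < nc \<Longrightarrow> d dvd A $$ (i,j)"
    and ij: "i < nr" "j < nc"
  shows "d dvd B $$ (i,j)"
proof -
  obtain P P' Q Q' where 1: "inverse_pair nr P P'" "inverse_pair nc Q Q'" "B = P * A * Q"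
    using eq unfolding smith_equiv_def by auto
  have [simp]: "A \<in> carrier_mat nr nc" using eq smith_equiv_carrier by blast
  have [simp]: "P \<in> carrier_mat nr nr" "Q \<in> carrier_mat nc nc"
    using 1 unfolding inverse_pair_def by auto
  have "d dvd (P * A) $$ (i,l)" if "l < nc" for l
    by (rule dvd_mult_mat_entries[of _ nr nr _ nc]) (use dvd ij that in auto)
  then show ?thesis unfolding 1
    by (intro dvd_mult_mat_entries[of _ nr nc _ nc]) (use ij mult_carrier_mat[of P nr nr A nc] in auto)
qed

text \<open>The transforming matrices are extended by a 1 in the corner. After a pivot has been
  split off, this lets an induction continue inside the remaining block.\<close>

lemma smith_equiv_block:
  assumes eq: "smith_equiv nr nc A B" and D: "D \<in> carrier_mat 1 1"
  shows "smith_equiv (Suc nr) (Suc nc) (four_block_mat D (0\<^sub>m 1 nc) (0\<^sub>m nr 1) A)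
           (four_block_mat D (0\<^sub>m 1 nc) (0\<^sub>m nr 1) B)"
proof -
  obtain P P' Q Q' where 1: "inverse_pair nr P P'" "inverse_pair nc Q Q'" "B = P * A * Q"
    using eq unfolding smith_equiv_def by auto
  have A [simp]: "A \<in> carrier_mat nr nc" using eq smith_equiv_carrier by blast
  let ?E = "\<lambda>n P. four_block_mat (1\<^sub>m 1) (0\<^sub>m 1 n) (0\<^sub>m n 1) (P :: int mat)"
  have ext: "inverse_pair (Suc n) (?E n R) (?E n R')" if "inverse_pair n R R'" for n R R'
  proof -
    have [simp]: "R \<in> carrier_mat n n" "R' \<in> carrier_mat n n"
      using that unfolding inverse_pair_def by auto
    have m: "?E n R * ?E n R' = ?E n (R * R')" if "R \<in> carrier_mat n n" "R' \<in> carrier_mat n n" for R R'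
      using that by (subst mult_four_block_mat[where ?nr1.0 = 1 and ?n1.0 = 1 and ?n2.0 = n and ?nr2.0 = n and ?nc1.0 = 1 and ?nc2.0 = n]) auto
    have "?E n R \<in> carrier_mat (1 + n) (1 + n)" "?E n R' \<in> carrier_mat (1 + n) (1 + n)"
      by (rule four_block_carrier_mat; simp)+
    then show ?thesis
      using that m[of R R'] m[of R' R] four_block_one_mat[of 1 n] unfolding inverse_pair_def
      by (simp del: One_nat_def four_block_one_mat add: plus_1_eq_Suc)
  qed
  have [simp]: "P \<in> carrier_mat nr nr" "Q \<in> carrier_mat nc nc" "P * A \<in> carrier_mat nr nc"
    using 1 unfolding inverse_pair_def by (auto intro: mult_carrier_mat)
  have "?E nr P * four_block_mat D (0\<^sub>m 1 nc) (0\<^sub>m nr 1) A = four_block_mat D (0\<^sub>m 1 nc) (0\<^sub>m nr 1) (P * A)"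
    using D left_mult_zero_mat[OF A] right_mult_zero_mat[of P nr nr] by (subst mult_four_block_mat[where ?nr1.0 = 1 and ?n1.0 = 1 and ?n2.0 = nr and ?nr2.0 = nr and ?nc1.0 = 1 and ?nc2.0 = nc]) auto
  moreover have "four_block_mat D (0\<^sub>m 1 nc) (0\<^sub>m nr 1) (P * A) * ?E nc Q = four_block_mat D (0\<^sub>m 1 nc) (0\<^sub>m nr 1) B"
    using D left_mult_zero_mat[of Q nc nc] right_mult_zero_mat[of "P * A" nr nc]
      left_add_zero_mat[of "P * A * Q" nr nc] mult_carrier_mat[of "P * A" nr nc Q nc] unfolding 1 by (subst mult_four_block_mat[where ?nr1.0 = 1 and ?n1.0 = 1 and ?n2.0 = nc and ?nr2.0 = nr and ?nc1.0 = 1 and ?nc2.0 = nc]) auto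
  moreover have "four_block_mat D (0\<^sub>m 1 nc) (0\<^sub>m nr 1) A \<in> carrier_mat (1 + nr) (1 + nc)"
    using D by (intro four_block_carrier_mat) auto
  ultimately show ?thesis
    by (intro smith_equivI[OF _ ext[OF 1(1)] ext[OF 1(2)]]) auto
qed

text \<open>Let d be the least positive number that occurs in the corner of any matrix equivalent to
  \<open>A\<close>. A nonzero remainder modulo d in the first row or column could be swapped into
  the corner and would contradict minimality, so d divides that row and column, and they can be
  cleared.\<close>

lemma smith_equiv_pivot:
  assumes A: "A \<in> carrier_mat (Suc nr) (Suc nc)" and nz: "A \<noteq> 0\<^sub>m (Suc nr) (Suc nc)"
  obtains d B where "0 < (d::nat)" "B \<in> carrier_mat nr nc" "\<And>i j. i < nr \<Longrightarrow> j < nc \<Longrightarrow> int d dvd B $$ (i,j)"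
    "smith_equiv (Suc nr) (Suc nc) A (four_block_mat (mat 1 1 (\<lambda>_. int d)) (0\<^sub>m 1 nc) (0\<^sub>m nr 1) B)"
proof -
  let ?E = "smith_equiv (Suc nr) (Suc nc)"
  let ?P = "\<lambda>d. 0 < d \<and> (\<exists>B. ?E A B \<and> B $$ (0,0) = int d)"
  obtain i j where ij: "i < Suc nr" "j < Suc nc" "A $$ (i,j) \<noteq> 0"
    using A nz by (metis eq_matI carrier_matD index_zero_mat)
  \<comment> \<open>A nonzero entry is swapped into the corner; if it is negative, the whole matrix
    is negated.\<close>
  have "\<exists>d. ?P d"
  proof -
    let ?B = "swapcols 0 j (swaprows 0 i A)"
    have AB: "?E A ?B"
      using smith_equiv_trans[OF smith_equiv_swaprows[OF A, of 0 i] smith_equiv_swapcols] A ij by simp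
    have B0: "?B $$ (0,0) = A $$ (i,j)" using A ij by auto
    show ?thesis
    proof (cases "A $$ (i,j) > 0")
      case True
      then show ?thesis using AB B0 by (intro exI[of _ "nat (A $$ (i,j))"] conjI exI[of _ ?B]) auto
    next
      case False
      have Bc: "?B \<in> carrier_mat (Suc nr) (Suc nc)" using AB smith_equiv_carrier by blast
      have "?E A (- ?B)" using smith_equiv_trans[OF AB smith_equiv_uminus[OF Bc]] .
      moreover have "(- ?B) $$ (0,0) = - A $$ (i,j)" using B0 A by simp
      ultimately show ?thesis using False ij
        by (intro exI[of _ "nat (- A $$ (i,j))"] conjI exI[of _ "- ?B"]) auto
    qed
  qed
  then have d: "?P (LEAST d. ?P d)" by (rule LeastI_ex)
  define d where "d = (LEAST d. ?P d)"
  have d: "?P d" using d unfolding d_def .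
  have least: "d \<le> e" if "?P e" for e using that unfolding d_def by (rule Least_le)
  have d0: "0 < d" using d by simp
  have small: "x = 0" if "?E A B" "B $$ (0,0) = x" "0 \<le> x" "x < int d" for B x
  proof (rule ccontr)
    assume "x \<noteq> 0"
    then have "?P (nat x)" using that by auto
    then show False using least that(4) by (metis nat_less_iff not_le that(3))
  qed
  text \<open>The next two facts are division with remainder followed by a swap into the corner.\<close>
  have col_dvd: "int d dvd B $$ (i,0)" if B: "?E A B" "B $$ (0,0) = int d" and i: "0 < i" "i < Suc nr" for B i
  proof -
    have Bc: "B \<in> carrier_mat (Suc nr) (Suc nc)" using smith_equiv_carrier(2)[OF B(1)] .
    let ?C = "swaprows 0 i (addrow (- (B $$ (i,0) div int d)) i 0 B)"
    have "?E B ?C"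
      using smith_equiv_trans[OF smith_equiv_addrow[OF Bc, of i 0] smith_equiv_swaprows[of _ _ _ 0 i]] Bc i by simp
    then have "?E A ?C" using B smith_equiv_trans by blast
    moreover have "?C $$ (0,0) = B $$ (i,0) mod int d"
      using Bc B i by (auto simp: minus_div_mult_eq_mod[symmetric])
    ultimately have "B $$ (i,0) mod int d = 0" using small d0 by simp
    then show ?thesis by (simp add: dvd_eq_mod_eq_0)
  qed
  have row_dvd: "int d dvd B $$ (0,j)" if B: "?E A B" "B $$ (0,0) = int d" and j: "0 < j" "j < Suc nc" for B j
  proof -
    have Bc: "B \<in> carrier_mat (Suc nr) (Suc nc)" using smith_equiv_carrier(2)[OF B(1)] .
    let ?C = "swapcols 0 j (addcol (- (B $$ (0,j) div int d)) j 0 B)"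
    have "?E B ?C"
      using smith_equiv_trans[OF smith_equiv_addcol[OF Bc, of j 0] smith_equiv_swapcols[of _ _ _ 0 j]] Bc j 
      by (auto simp: mat_addcol_def)
    then have "?E A ?C" using B smith_equiv_trans by blast
    moreover have "?C $$ (0,0) = B $$ (0,j) mod int d"
      using Bc B j by (auto simp: minus_div_mult_eq_mod[symmetric])
    ultimately have "B $$ (0,j) mod int d = 0" using small d0 by simp
    then show ?thesis by (simp add: dvd_eq_mod_eq_0)
  qed
  have clear_col: "\<exists>B. ?E A B \<and> B $$ (0,0) = int d \<and> (\<forall>i. 0 < i \<and> i < s \<longrightarrow> B $$ (i,0) = 0)"
    if "s \<le> Suc nr" for s
    using that
  proof (induction s)
    case 0
    then show ?case using d by auto
  next
    case (Suc s)
    from Suc.IH[OF Suc_leD[OF Suc.prems]] obtain B where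
      B: "?E A B" "B $$ (0,0) = int d" "\<And>i. 0 < i \<Longrightarrow> i < s \<Longrightarrow> B $$ (i,0) = 0"
      by blast
    have Bc: "B \<in> carrier_mat (Suc nr) (Suc nc)" using smith_equiv_carrier(2)[OF B(1)] .
    show ?case
    proof (cases "s = 0")
      case True
      then show ?thesis using B by auto
    next
      case False
      then have "int d dvd B $$ (s,0)" using col_dvd B Suc.prems by simp
      then obtain q where q: "B $$ (s,0) = int d * q" by (elim dvdE)
      let ?C = "addrow (- q) s 0 B"
      have C: "?C $$ (i,0) = (if i = s then 0 else B $$ (i,0))" if "i < Suc nr" for i
        using that Bc B(2) q by (subst index_mat_addrow) auto
      have "?E A ?C"
        using smith_equiv_trans[OF B(1) smith_equiv_addrow[OF Bc, of s 0]] False Suc.prems by simp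
      moreover have "?C $$ (0,0) = int d" using C[of 0] False B(2) by simp
      moreover have "?C $$ (i,0) = 0" if "0 < i" "i < Suc s" for i
        using that B(3)[of i] C[of i] Suc.prems by (cases "i = s") auto
      ultimately show ?thesis by blast
    qed
  qed
  \<comment> \<open>Each operation adds a multiple of column 0 to another column, so the first
    column stays cleared.\<close>
  have clear_row: "\<exists>B. ?E A B \<and> B $$ (0,0) = int d \<and> (\<forall>i. 0 < i \<and> i < Suc nr \<longrightarrow> B $$ (i,0) = 0) \<and>
      (\<forall>j. 0 < j \<and> j < s \<longrightarrow> B $$ (0,j) = 0)"
    if "s \<le> Suc nc" for s
    using that
  proof (induction s)
    case 0
    obtain B where "?E A B \<and> B $$ (0,0) = int d \<and> (\<forall>i. 0 < i \<and> i < Suc nr \<longrightarrow> B $$ (i,0) = 0)"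
      using clear_col[OF order_refl] ..
    then show ?case by (intro exI[of _ B]) simp
  next
    case (Suc s)
    obtain B where B': "?E A B \<and> B $$ (0,0) = int d \<and> (\<forall>i. 0 < i \<and> i < Suc nr \<longrightarrow> B $$ (i,0) = 0) \<and>
      (\<forall>j. 0 < j \<and> j < s \<longrightarrow> B $$ (0,j) = 0)"
      using Suc.IH[OF Suc_leD[OF Suc.prems]] ..
    have B: "?E A B" "B $$ (0,0) = int d" "\<And>i. 0 < i \<Longrightarrow> i < Suc nr \<Longrightarrow> B $$ (i,0) = 0"
       "\<And>j. 0 < j \<Longrightarrow> j < s \<Longrightarrow> B $$ (0,j) = 0"
      using B' by simp_all
    have Bc: "B \<in> carrier_mat (Suc nr) (Suc nc)" using smith_equiv_carrier(2)[OF B(1)] .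
    show ?case
    proof (cases "s = 0")
      case True
      then show ?thesis using B by (intro exI[of _ B]) simp
    next
      case False
      then have "int d dvd B $$ (0,s)" using row_dvd B Suc.prems by simp
      then obtain q where q: "B $$ (0,s) = int d * q" by (elim dvdE)
      let ?C = "addcol (- q) s 0 B"
      have C: "?C $$ (0,j) = (if j = s then 0 else B $$ (0,j))" if "j < Suc nc" for j
        using that Bc B(2) q by (subst index_mat_addcol) auto
      have "?E A ?C"
        using smith_equiv_trans[OF B(1) smith_equiv_addcol[OF Bc, of s 0]] False Suc.prems by simp
      moreover have "?C $$ (0,0) = int d" using C[of 0] False B(2) by simp
      moreover have "?C $$ (0,j) = 0" if "0 < j" "j < Suc s" for j
        using that B(4)[of j] C[of j] Suc.prems by (cases "j = s") auto
      moreover have "?C $$ (i,0) = 0" if "0 < i" "i < Suc nr" for i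
        using that Bc False B(3)[of i] by (subst index_mat_addcol) auto
      ultimately show ?thesis by (intro exI[of _ ?C] conjI allI impI) simp_all
    qed
  qed
  obtain B where B': "?E A B \<and> B $$ (0,0) = int d \<and> (\<forall>i. 0 < i \<and> i < Suc nr \<longrightarrow> B $$ (i,0) = 0) \<and>
      (\<forall>j. 0 < j \<and> j < Suc nc \<longrightarrow> B $$ (0,j) = 0)"
    using clear_row[OF order_refl] ..
  have B: "?E A B" "B $$ (0,0) = int d" "\<And>i. 0 < i \<Longrightarrow> i < Suc nr \<Longrightarrow> B $$ (i,0) = 0"
       "\<And>j. 0 < j \<Longrightarrow> j < Suc nc \<Longrightarrow> B $$ (0,j) = 0"
    using B' by simp_all
  have Bc: "B \<in> carrier_mat (Suc nr) (Suc nc)" using smith_equiv_carrier(2)[OF B(1)] .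
  define B' where "B' = mat nr nc (\<lambda>(i,j). B $$ (Suc i, Suc j))"
  have "B = four_block_mat (mat 1 1 (\<lambda>_. int d)) (0\<^sub>m 1 nc) (0\<^sub>m nr 1) B'"
    by (rule eq_matI) (use Bc B in \<open>auto simp: B'_def\<close>)
  moreover have "int d dvd B' $$ (i,j)" if ij: "i < nr" "j < nc" for i j
  proof -
    \<comment> \<open>Adding a lower row to the first one leaves the corner at d, since column 0 is
      cleared, and moves a block entry into the first row, where \<open>row_dvd\<close>
      applies.\<close>
    let ?C = "addrow 1 0 (Suc i) B"
    have "?E A ?C" using smith_equiv_trans[OF B(1) smith_equiv_addrow[OF Bc, of 0 "Suc i"]] ij by simp
    then have "int d dvd ?C $$ (0, Suc j)" using row_dvd[of ?C "Suc j"] B Bc ij by simp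
    then show ?thesis using B Bc ij by (simp add: B'_def)
  qed
  ultimately show ?thesis using that[of d B'] d0 B by (simp add: B'_def)
qed

section \<open>Diagonal forms and their existence\<close>

lemma smith_diag_carrier [simp]: "smith_diag nr nc es \<in> carrier_mat nr nc"
  by (simp add: smith_diag_def)

lemma smith_diag_dims [simp]: "dim_row (smith_diag nr nc es) = nr" "dim_col (smith_diag nr nc es) = nc"
  by (simp_all add: smith_diag_def)

lemma smith_diag_index:
  "i < nr \<Longrightarrow> j < nc \<Longrightarrow> smith_diag nr nc es $$ (i,j) = (if i = j \<and> i < length es then int (es ! i) else 0)"
  by (simp add: smith_diag_def)

lemma smith_diag_Cons:
  "smith_diag (Suc nr) (Suc nc) (e # es) =
     four_block_mat (mat 1 1 (\<lambda>_. int e)) (0\<^sub>m 1 nc) (0\<^sub>m nr 1) (smith_diag nr nc es)"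
  by (rule eq_matI) (auto simp: smith_diag_index nth_Cons')

text \<open>Bounds on the length replace the rank condition of
  \<open>is_elementary_divisors\<close>, so that the list can be built by induction without any
  mention of rank.\<close>

definition smith_form :: "nat \<Rightarrow> nat \<Rightarrow> int mat \<Rightarrow> nat list \<Rightarrow> bool" where
  "smith_form nr nc A es \<longleftrightarrow> (\<forall>e \<in> set es. 0 < e) \<and> sorted_wrt (dvd) es \<and>
     length es \<le> nr \<and> length es \<le> nc \<and> smith_equiv nr nc A (smith_diag nr nc es)"

text \<open>The pivot divides every entry of the remaining block and hence every diagonal entry of
  the block's Smith form, so prepending it keeps the divisibility chain.\<close>

lemma smith_form_exists:
  assumes "A \<in> carrier_mat nr nc"
  shows "\<exists>es. smith_form nr nc A es"
  using assms
proof (induction nr arbitrary: nc A)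
  case 0
  then have "A = smith_diag 0 nc []" by (intro eq_matI) auto
  then show ?case using 0 smith_equiv_refl[OF 0]
    by (intro exI[of _ "[]"]) (simp add: smith_form_def)
next
  case (Suc nr)
  show ?case
  proof (cases "A = 0\<^sub>m (Suc nr) nc")
    case True
    then have "A = smith_diag (Suc nr) nc []" by (intro eq_matI) (auto simp: smith_diag_index)
    then show ?thesis using smith_equiv_refl[OF Suc.prems]
      by (intro exI[of _ "[]"]) (simp add: smith_form_def)
  next
    case False
    have "nc \<noteq> 0" using False Suc.prems by (metis carrier_matD eq_matI index_zero_mat(2,3) less_nat_zero_code)
    then obtain nc' where nc: "nc = Suc nc'" by (cases nc) auto
    obtain d B where d: "0 < d" "B \<in> carrier_mat nr nc'" "\<And>i j. i < nr \<Longrightarrow> j < nc' \<Longrightarrow> int d dvd B $$ (i,j)"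
      "smith_equiv (Suc nr) nc A (four_block_mat (mat 1 1 (\<lambda>_. int d)) (0\<^sub>m 1 nc') (0\<^sub>m nr 1) B)"
      using smith_equiv_pivot[of A nr nc'] False Suc.prems unfolding nc by blast
    obtain es where es: "smith_form nr nc' B es" using Suc.IH d(2) by blast
    have "d dvd e" if e: "e \<in> set es" for e
    proof -
      obtain i where i: "i < length es" "e = es ! i" using e by (auto simp: in_set_conv_nth)
      have "int d dvd smith_diag nr nc' es $$ (i,i)"
        using smith_equiv_dvd_entries[of nr nc' B _ "int d" i i] d(3) es i unfolding smith_form_def by auto
      then show ?thesis using i es unfolding smith_form_def by (simp add: smith_diag_index)
    qed
    moreover have "smith_equiv (Suc nr) nc A (smith_diag (Suc nr) nc (d # es))"
      using smith_equiv_trans[OF d(4)[unfolded nc] smith_equiv_block[of nr nc' B "smith_diag nr nc' es"]] es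
      unfolding smith_form_def by (simp add: smith_diag_Cons nc)
    ultimately have "smith_form (Suc nr) nc A (d # es)" using es d(1) unfolding smith_form_def nc by auto
    then show ?thesis by blast
  qed
qed

section \<open>Rank\<close>

text \<open>The product is a sum of s outer products of rank at most 1, and rank is subadditive;
  \<open>M t\<close> is the sum of the first t of them.\<close>

lemma (in vec_space) rank_mult_le:
  assumes "B \<in> carrier_mat n s" "C \<in> carrier_mat s nc"
  shows "rank (B * C) \<le> s"
proof -
  define M where "M t = mat n nc (\<lambda>(i,j). \<Sum>l<t. B $$ (i,l) * C $$ (l,j))" for t
  have "rank (M t) \<le> t" for t
  proof (induction t)
    case 0
    have "M 0 = 0\<^sub>m n nc" by (intro eq_matI) (auto simp: M_def)
    then show ?case using rank_0I by simp
  next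
    case (Suc t)
    let ?R = "mat n nc (\<lambda>(i,j). B $$ (i,t) * C $$ (t,j))"
    have "M (Suc t) = M t + ?R" by (intro eq_matI) (auto simp: M_def)
    moreover have "rank (M t + ?R) \<le> rank (M t) + rank ?R"
      by (rule rank_subadditive[where nc = nc]) (auto simp: M_def)
    moreover have "rank ?R \<le> 1" by (rule rank_le_1_product_entries[where nc = nc]) auto
    ultimately show ?case using Suc by simp
  qed
  moreover have "B * C = M s"
    using assms by (intro eq_matI) (auto simp: M_def scalar_prod_def atLeast0LessThan)
  ultimately show ?thesis by metis
qed

text \<open>The columns of \<open>B\<close> are a maximal independent set of columns of
  \<open>A\<close>; by maximality they span the others, whose coordinates fill \<open>C\<close>.
  Together with \<open>rank_mult_le\<close> this makes the rank the least inner dimension of a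
  factorization.\<close>

lemma (in vec_space) rank_factorization:
  assumes A: "A \<in> carrier_mat n nc"
  obtains B C where "B \<in> carrier_mat n (rank A)" "C \<in> carrier_mat (rank A) nc" "A = B * C"
proof -
  have fin: "finite (set (cols A))" and sub: "set (cols A) \<subseteq> carrier_vec n"
    using cols_dim[of A] carrier_matD(1)[OF A] by simp_all
  have "lin_indpt {}" by (simp add: lin_dep_def)
  then obtain U where U: "finite U" "maximal U (\<lambda>T. T \<subseteq> set (cols A) \<and> lin_indpt T)"
    using maximal_exists_superset[of "set (cols A)" "\<lambda>T. T \<subseteq> set (cols A) \<and> lin_indpt T" "{}"] by auto
  have rk: "rank A = card U" using rank_card_indpt[OF A U(2)] .
  have U': "U \<subseteq> set (cols A)" "lin_indpt U" using U unfolding maximal_def by auto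
  have Uc: "U \<subseteq> carrier_vec n" using U' sub by blast
  obtain us where us: "set us = U" "distinct us" using finite_distinct_list[OF U(1)] by blast
  define B where "B = mat_of_cols n us"
  have len: "length us = rank A" using us rk distinct_card[OF us(2)] by simp
  have B: "B \<in> carrier_mat n (rank A)" "cols B = us"
    using us Uc len by (auto simp: B_def)
  have "\<exists>x. x \<in> carrier_vec (rank A) \<and> col A j = B *\<^sub>v x" if j: "j < nc" for j
  proof -
    have v: "col A j \<in> set (cols A)" using A j by (simp add: cols_def)
    have "col A j \<in> span U"
    proof (rule ccontr)
      assume notin: "col A j \<notin> span U"
      then have "lin_indpt (U \<union> {col A j})"
        using lin_dep_iff_in_span[OF Uc U'(2), of "col A j"] v sub span_mem[OF Uc, of "col A j"] by auto
      moreover have "col A j \<notin> U" using notin span_mem[OF Uc] by blast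
      ultimately show False using U(2) v U'(1) unfolding maximal_def by blast
    qed
    then obtain a where "lincomb a U = col A j" using finite_in_span[OF U(1)] Uc by auto
    then have "col A j = B *\<^sub>v vec (rank A) (\<lambda>i. a (col B i))"
      using mat_mult_eq_lincomb[OF B(1), of a] us B by simp
    then show ?thesis by (intro exI[of _ "vec (rank A) (\<lambda>i. a (col B i))"]) auto
  qed
  then obtain x where x: "\<And>j. j < nc \<Longrightarrow> x j \<in> carrier_vec (rank A) \<and> col A j = B *\<^sub>v x j" by metis
  define C where "C = mat (rank A) nc (\<lambda>(i,j). x j $ i)"
  have "A = B * C"
  proof (rule eq_matI)
    fix i j assume ij: "i < dim_row (B * C)" "j < dim_col (B * C)"
    then have ij': "i < n" "j < nc" using B by (auto simp: C_def)
    have xj: "x j \<in> carrier_vec (rank A)" "col A j = B *\<^sub>v x j" using x[OF ij'(2)] by blast+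
    have C: "col C j = x j" using xj(1) ij' by (intro eq_vecI) (simp_all add: C_def)
    have "A $$ (i,j) = col A j $ i" using A ij' by simp
    also have "\<dots> = row B i \<bullet> x j" unfolding xj(2) using B(1) ij' by simp
    also have "\<dots> = (B * C) $$ (i,j)" unfolding C[symmetric] using ij by simp
    finally show "A $$ (i,j) = (B * C) $$ (i,j)" .
  qed (use A B(1) in \<open>simp_all add: C_def\<close>)
  moreover have "C \<in> carrier_mat (rank A) nc" by (simp add: C_def)
  ultimately show ?thesis by (intro that[OF B(1)])
qed

text \<open>Stated over an integral domain because it serves both the rational rank argument and the
  integer vectors below. The control of the support comes from solving only in the first r unknowns,
  with zero rows added to make the system square.\<close>

lemma underdetermined_system:
  fixes M :: "'a :: idom mat"
  assumes M: "M \<in> carrier_mat s nc" and "s < r" "r \<le> nc"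
  obtains v where "v \<in> carrier_vec nc" "v \<noteq> 0\<^sub>v nc" "\<And>j. r \<le> j \<Longrightarrow> j < nc \<Longrightarrow> v $ j = 0"
    "M *\<^sub>v v = 0\<^sub>v s"
proof -
  define N where "N = mat r r (\<lambda>(i,j). if i < s then M $$ (i,j) else 0)"
  have N: "N \<in> carrier_mat r r" by (simp add: N_def)
  \<comment> \<open>Row s of \<open>N\<close> is zero, so multiplying it by 0 changes nothing, while
    the determinant gets the factor 0.\<close>
  have "multrow s 0 N = N" by (rule eq_matI) (auto simp: N_def)
  then have "det N = 0" using det_multrow[of s r N 0] N assms by simp
  then obtain w where w: "w \<in> carrier_vec r" "w \<noteq> 0\<^sub>v r" "N *\<^sub>v w = 0\<^sub>v r"
    using det_0_iff_vec_prod_zero[OF N] by blast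
  define v where "v = vec nc (\<lambda>j. if j < r then w $ j else 0)"
  obtain j where j: "j < r" "w $ j \<noteq> 0" using w by (metis carrier_vecD eq_vecI index_zero_vec)
  have "v \<noteq> 0\<^sub>v nc"
  proof
    assume "v = 0\<^sub>v nc"
    then have "v $ j = 0" using j assms by simp
    then show False using j assms by (simp add: v_def)
  qed
  moreover have "M *\<^sub>v v = 0\<^sub>v s"
  proof (rule eq_vecI)
    fix i assume "i < dim_vec (0\<^sub>v s :: 'a vec)"
    then have i: "i < s" by simp
    have "(M *\<^sub>v v) $ i = (\<Sum>l<nc. M $$ (i,l) * (if l < r then w $ l else 0))"
      using M i by (simp add: scalar_prod_def v_def atLeast0LessThan)
    also have "\<dots> = (\<Sum>l<r. M $$ (i,l) * w $ l)"
      using assms by (intro sum.mono_neutral_cong_right) auto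
    also have "\<dots> = (N *\<^sub>v w) $ i"
      using i assms w(1) by (simp add: scalar_prod_def N_def atLeast0LessThan)
    finally show "(M *\<^sub>v v) $ i = 0\<^sub>v s $ i" using w i assms by simp
  qed (use M in auto)
  ultimately show ?thesis using that[of v] by (simp add: v_def)
qed

lemma of_int_smith_diag_mult_vec:
  fixes v :: "'a :: ring_1 vec"
  assumes "v \<in> carrier_vec nc" "i < nr" "length es \<le> nc"
  shows "(map_mat of_int (smith_diag nr nc es) *\<^sub>v v) $ i = (if i < length es then of_nat (es ! i) * v $ i else 0)"
proof -
  have "(map_mat of_int (smith_diag nr nc es) *\<^sub>v v) $ i =
      (\<Sum>j<nc. (if i = j \<and> i < length es then of_nat (es ! i) * v $ i else 0))"
    using assms by (auto simp: scalar_prod_def smith_diag_index atLeast0LessThan intro!: sum.cong)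
  also have "\<dots> = (if i < length es then of_nat (es ! i) * v $ i else 0)"
    using assms by (cases "i < length es") (simp_all add: sum.delta)
  finally show ?thesis .
qed

lemma mult_mat_assoc4:
  fixes P :: "'a :: semiring_0 mat"
  assumes "P \<in> carrier_mat n1 n2" "B \<in> carrier_mat n2 n3" "C \<in> carrier_mat n3 n4" "Q \<in> carrier_mat n4 n5"
  shows "P * (B * C) * Q = (P * B) * (C * Q)"
  using assms assoc_mult_mat[OF assms(1-3)]
    assoc_mult_mat[OF mult_carrier_mat[OF assms(1,2)] assms(3,4)] by metis

text \<open>Upper bound: the diagonal matrix, and with it \<open>A\<close>, factors through
  \<open>length es\<close> coordinates. Lower bound: a factorization of \<open>A\<close> through
  fewer coordinates would give a nonzero vector supported on the first \<open>length es\<close>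
  coordinates and killed by the diagonal matrix, whose entries there are positive.\<close>

lemma smith_equiv_rank:
  assumes eq: "smith_equiv nr nc A (smith_diag nr nc es)"
    and len: "length es \<le> nr" "length es \<le> nc" and pos: "\<forall>e \<in> set es. 0 < e"
  shows "int_rank A = length es"
proof -
  let ?h = "map_mat rat_of_int"
  let ?r = "length es" and ?S = "smith_diag nr nc es"
  interpret vec_space "TYPE(rat)" nr .
  have A: "A \<in> carrier_mat nr nc" using eq smith_equiv_carrier by blast
  have rk: "int_rank A = rank (?h A)" using A by (simp add: int_rank_def)
  obtain P P' Q Q' where PQ: "inverse_pair nr P P'" "inverse_pair nc Q Q'" "?S = P * A * Q"
    using eq unfolding smith_equiv_def by auto
  obtain R R' T T' where RT: "inverse_pair nr R R'" "inverse_pair nc T T'" "A = R * ?S * T"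
    using smith_equiv_sym[OF eq] unfolding smith_equiv_def by auto
  have c: "P \<in> carrier_mat nr nr" "Q \<in> carrier_mat nc nc" "R \<in> carrier_mat nr nr" "T \<in> carrier_mat nc nc"
    using PQ RT unfolding inverse_pair_def by auto
  show ?thesis
  proof (rule antisym)
    define D where "D = mat nr ?r (\<lambda>(i,j). if i = j then int (es ! i) else 0)"
    define I where "I = mat ?r nc (\<lambda>(i,j). if i = j then 1 else 0 :: int)"
    have DI: "D \<in> carrier_mat nr ?r" "I \<in> carrier_mat ?r nc" by (auto simp: D_def I_def)
    have "?S = D * I"
    proof (rule eq_matI)
      fix i j assume "i < dim_row (D * I)" "j < dim_col (D * I)"
      then have ij: "i < nr" "j < nc" using DI by auto
      have "(D * I) $$ (i,j) = (\<Sum>l<?r. D $$ (i,l) * I $$ (l,j))"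
        using ij DI by (simp add: scalar_prod_def atLeast0LessThan)
      also have "\<dots> = (\<Sum>l<?r. if l = i then (if i = j then int (es ! i) else 0) else 0)"
        using ij by (intro sum.cong) (auto simp: D_def I_def)
      also have "\<dots> = (if i = j \<and> i < ?r then int (es ! i) else 0)" by simp
      finally show "?S $$ (i,j) = (D * I) $$ (i,j)" using ij by (simp add: smith_diag_index)
    qed (use DI in auto)
    then have "A = (R * D) * (I * T)"
      using assoc_mult_mat[of R nr nr D ?r I nc] assoc_mult_mat[of "R * D" nr ?r I nc T nc] RT(3) c DI
        mult_carrier_mat[of R nr nr D ?r] by simp
    then have "?h A = ?h (R * D) * ?h (I * T)"
      using of_int_hom.mat_hom_mult[of "R * D" nr ?r "I * T" nc] c DI by auto
    then show "int_rank A \<le> ?r"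
      using rank_mult_le[of "?h (R * D)" ?r "?h (I * T)" nc] c DI rk by auto
    show "?r \<le> int_rank A"
    proof (rule ccontr)
      assume "\<not> ?r \<le> int_rank A"
      then have less: "rank (?h A) < ?r" using rk by simp
      have hA: "?h A \<in> carrier_mat nr nc" using A by simp
      obtain B C where BC: "B \<in> carrier_mat nr (rank (?h A))" "C \<in> carrier_mat (rank (?h A)) nc" "?h A = B * C"
        using rank_factorization[OF hA] .
      obtain v where v: "v \<in> carrier_vec nc" "v \<noteq> 0\<^sub>v nc" "\<And>j. ?r \<le> j \<Longrightarrow> j < nc \<Longrightarrow> v $ j = 0"
        "(C * ?h Q) *\<^sub>v v = 0\<^sub>v (rank (?h A))"
        using underdetermined_system[of "C * ?h Q" "rank (?h A)" nc ?r] less len BC c by auto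
      have PB: "?h P * B \<in> carrier_mat nr (rank (?h A))" and CQ: "C * ?h Q \<in> carrier_mat (rank (?h A)) nc"
        using mult_carrier_mat[of "?h P" nr nr B] mult_carrier_mat[of C _ nc "?h Q" nc] c BC by auto
      have zero: "M *\<^sub>v 0\<^sub>v s = 0\<^sub>v nr" if "M \<in> carrier_mat nr s" for M :: "rat mat" and s
        using that by (intro eq_vecI) auto
      have "?h ?S = ?h (P * A) * ?h Q"
        unfolding PQ(3) by (rule of_int_hom.mat_hom_mult[OF mult_carrier_mat[OF c(1) A] c(2)])
      also have "?h (P * A) = ?h P * ?h A" by (rule of_int_hom.mat_hom_mult[OF c(1) A])
      also have "?h P * ?h A * ?h Q = ?h P * (B * C) * ?h Q" using BC(3) by (rule arg_cong)
      also have "\<dots> = (?h P * B) * (C * ?h Q)"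
        by (rule mult_mat_assoc4[OF _ BC(1,2)]) (use c in auto)
      finally have "?h ?S *\<^sub>v v = (?h P * B) *\<^sub>v ((C * ?h Q) *\<^sub>v v)"
        using assoc_mult_mat_vec[OF PB CQ v(1)] by metis
      also have "\<dots> = 0\<^sub>v nr"
        unfolding v(4) using zero[OF PB] .
      finally have Sv: "?h ?S *\<^sub>v v = 0\<^sub>v nr" .
      have "v $ j = 0" if j: "j < nc" for j
      proof (cases "j < ?r")
        case True
        then have "of_nat (es ! j) * v $ j = 0"
          using of_int_smith_diag_mult_vec[OF v(1), of j nr es] len Sv by simp
        moreover have "es ! j \<noteq> 0" using pos True by (metis nth_mem less_numeral_extra(3))
        ultimately show ?thesis by simp
      next
        case False
        then show ?thesis using v j by simp
      qed
      then show False using v(1,2) by (metis carrier_vecD eq_vecI index_zero_vec)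
    qed
  qed
qed

text \<open>The predicates differ in how they tie the length of the list to the matrix: the rank
  condition implies the two length bounds, and conversely a diagonal form with positive entries
  determines the rank.\<close>

lemma is_elementary_divisors_iff_smith_form:
  assumes A: "A \<in> carrier_mat nr nc"
  shows "is_elementary_divisors A es \<longleftrightarrow> smith_form nr nc A es"
proof
  assume es: "is_elementary_divisors A es"
  interpret vec_space "TYPE(rat)" nr .
  let ?h = "map_mat rat_of_int"
  have hA: "?h A \<in> carrier_mat nr nc" using A by simp
  have len: "length es = rank (?h A)" using es A unfolding is_elementary_divisors_def int_rank_def by simp
  have "rank (?h A) \<le> nr" using rank_mult_le[of "1\<^sub>m nr" nr "?h A" nc] hA by simp
  moreover have "rank (?h A) \<le> nc" using rank_le_nc[OF hA] .
  moreover have "smith_equiv nr nc A (smith_diag nr nc es)"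
  proof -
    obtain P Q where PQ: "P \<in> carrier_mat nr nr" "invertible_mat P" "Q \<in> carrier_mat nc nc" "invertible_mat Q"
      "P * A * Q = smith_diag nr nc es"
      using es A unfolding is_elementary_divisors_def by auto
    obtain P' Q' where "inverse_pair nr P P'" "inverse_pair nc Q Q'"
      using PQ invertible_mat_iff_inverse_pair by blast
    then show ?thesis using smith_equivI[OF A] PQ(5) by metis
  qed
  ultimately show "smith_form nr nc A es"
    using es len unfolding is_elementary_divisors_def smith_form_def by simp
next
  assume es: "smith_form nr nc A es"
  then have eq: "smith_equiv nr nc A (smith_diag nr nc es)" unfolding smith_form_def by simp
  have "int_rank A = length es"
    using smith_equiv_rank[OF eq] es unfolding smith_form_def by simp
  moreover have "\<exists>P Q. P \<in> carrier_mat nr nr \<and> invertible_mat P \<and> Q \<in> carrier_mat nc nc \<and> invertible_mat Q \<and>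
      P * A * Q = smith_diag nr nc es"
  proof -
    obtain P P' Q Q' where PQ: "inverse_pair nr P P'" "inverse_pair nc Q Q'" "smith_diag nr nc es = P * A * Q"
      using eq unfolding smith_equiv_def by auto
    then have "P \<in> carrier_mat nr nr" "Q \<in> carrier_mat nc nc" unfolding inverse_pair_def by auto
    then show ?thesis using PQ invertible_mat_iff_inverse_pair by (intro exI[of _ P] exI[of _ Q]) auto
  qed
  ultimately show "is_elementary_divisors A es"
    using es A unfolding is_elementary_divisors_def smith_form_def by simp
qed

lemma elementary_divisors_smith_form:
  assumes "A \<in> carrier_mat nr nc"
  shows "smith_form nr nc A (elementary_divisors A)"
  using smith_form_exists[OF assms] someI_ex[of "is_elementary_divisors A"]
  unfolding elementary_divisors_def is_elementary_divisors_iff_smith_form[OF assms] by blast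

lemma length_elementary_divisors:
  assumes "A \<in> carrier_mat nr nc"
  shows "length (elementary_divisors A) = int_rank A"
  using elementary_divisors_smith_form[OF assms]
  unfolding is_elementary_divisors_iff_smith_form[OF assms, symmetric] is_elementary_divisors_def by simp

section \<open>Divisibility of elementary divisors\<close>

text \<open>A nonzero integer solution is divided by the gcd of its entries. The entries from r on
  are zero, so the gcd of the first r already divides all of them.\<close>

lemma primitive_solution:
  fixes M :: "int mat"
  assumes M: "M \<in> carrier_mat s nc" and sr: "s < r" "r \<le> nc"
  obtains v where "v \<in> carrier_vec nc" "\<And>j. r \<le> j \<Longrightarrow> j < nc \<Longrightarrow> v $ j = 0"
    "M *\<^sub>v v = 0\<^sub>v s" "Gcd ((\<lambda>j. v $ j) ` {..<r}) = 1"
proof -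
  obtain w where w: "w \<in> carrier_vec nc" "w \<noteq> 0\<^sub>v nc" "\<And>j. r \<le> j \<Longrightarrow> j < nc \<Longrightarrow> w $ j = 0"
    "M *\<^sub>v w = 0\<^sub>v s"
    by (rule underdetermined_system[OF M sr]) (rule that; assumption)
  define g where "g = Gcd ((\<lambda>j. w $ j) ` {..<r})"
  have "g \<noteq> 0"
  proof
    assume "g = 0"
    then have "w $ j = 0" if "j < nc" for j
    proof (cases "j < r")
      case True
      have "(\<lambda>j. w $ j) ` {..<r} \<subseteq> {0}" using \<open>g = 0\<close> unfolding g_def Gcd_0_iff .
      then show ?thesis using True by blast
    next
      case False
      then show ?thesis using w(3)[OF _ that] by simp
    qed
    then have "w = 0\<^sub>v nc" using w(1) by (intro eq_vecI) auto
    with w(2) show False ..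
  qed
  moreover have "g \<ge> 0" by (simp add: g_def)
  ultimately have g: "g > 0" by simp
  have dvd: "g dvd w $ j" if "j < nc" for j
  proof (cases "j < r")
    case True
    then show ?thesis unfolding g_def by (intro Gcd_dvd) simp
  next
    case False
    then show ?thesis using w(3)[OF _ that] by simp
  qed
  define v where "v = vec nc (\<lambda>j. w $ j div g)"
  have v: "v \<in> carrier_vec nc" by (simp add: v_def)
  have wv: "w = g \<cdot>\<^sub>v v" using dvd w(1) by (intro eq_vecI) (auto simp: v_def)
  have "M *\<^sub>v v = 0\<^sub>v s"
  proof (rule eq_vecI)
    fix i assume i: "i < dim_vec (0\<^sub>v s :: int vec)"
    have "(M *\<^sub>v w) $ i = g * (M *\<^sub>v v) $ i"
      unfolding wv using i M v by (simp add: scalar_prod_smult_distrib[of _ nc])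
    then show "(M *\<^sub>v v) $ i = 0\<^sub>v s $ i" using w(4) g i by simp
  qed (use M in simp)
  moreover have "Gcd ((\<lambda>j. v $ j) ` {..<r}) = 1"
  proof -
    have "(\<lambda>j. w $ j) ` {..<r} = (*) g ` (\<lambda>j. v $ j) ` {..<r}"
      unfolding image_image using dvd sr by (intro image_cong) (auto simp: v_def)
    then have "g = Gcd ((*) g ` (\<lambda>j. v $ j) ` {..<r})" unfolding g_def by (rule arg_cong)
    also have "\<dots> = \<bar>g * Gcd ((\<lambda>j. v $ j) ` {..<r})\<bar>" by (simp add: Gcd_mult)
    finally show ?thesis using g by (simp add: abs_mult)
  qed
  moreover have "v $ j = 0" if "r \<le> j" "j < nc" for j using w(3)[OF that] that by (simp add: v_def)
  ultimately show ?thesis using v by (intro that[of v])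
qed

lemma smith_diag_mult_vec:
  fixes v :: "int vec"
  assumes "v \<in> carrier_vec nc" "i < nr" "length es \<le> nc"
  shows "(smith_diag nr nc es *\<^sub>v v) $ i = (if i < length es then int (es ! i) * v $ i else 0)"
proof -
  have "map_mat of_int (smith_diag nr nc es) = smith_diag nr nc es" by (rule eq_matI) auto
  then show ?thesis using of_int_smith_diag_mult_vec[OF assms] by simp
qed

lemma dvd_mult_mat_vec:
  fixes M :: "int mat"
  assumes "M \<in> carrier_mat nr nc" "v \<in> carrier_vec nc" "\<And>j. j < nc \<Longrightarrow> d dvd v $ j" "i < nr"
  shows "d dvd (M *\<^sub>v v) $ i"
  using assms by (auto simp: scalar_prod_def intro!: dvd_sum)

text \<open>
  Writing the Smith form of \<open>A * B\<close> as \<open>U * S * V\<close> with \<open>S\<close> that of \<open>A\<close>, choose a primitive vector v supported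
  on the first \<open>l + 1\<close> coordinates such that \<open>V v\<close> vanishes on the first l. Then d divides
  \<open>U S V v\<close>, whose entries are \<open>es' ! i * v $ i\<close>, and primitivity of v removes the second factor.
\<close>

lemma smith_form_mult_dvd:
  assumes A: "smith_form nr nc A es" and B: "B \<in> carrier_mat nc nc'" and AB: "smith_form nr nc' (A * B) es'"
    and l: "l < length es'" "l \<le> length es"
    and d: "\<And>i. l \<le> i \<Longrightarrow> i < length es \<Longrightarrow> d dvd int (es ! i)"
  shows "d dvd int (es' ! l)"
proof -
  let ?S = "smith_diag nr nc es" and ?S' = "smith_diag nr nc' es'"
  have Ac: "A \<in> carrier_mat nr nc" using A smith_equiv_carrier unfolding smith_form_def by blast
  obtain P P' Q Q' where PQ: "inverse_pair nr P P'" "inverse_pair nc' Q Q'" "?S' = P * (A * B) * Q"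
    using AB unfolding smith_form_def smith_equiv_def by auto
  obtain R R' T T' where RT: "inverse_pair nr R R'" "inverse_pair nc T T'" "A = R * ?S * T"
    using smith_equiv_sym[of nr nc A ?S] A unfolding smith_form_def smith_equiv_def by auto
  have c: "P \<in> carrier_mat nr nr" "Q \<in> carrier_mat nc' nc'" "R \<in> carrier_mat nr nr" "T \<in> carrier_mat nc nc"
    using PQ RT unfolding inverse_pair_def by auto
  have S: "?S \<in> carrier_mat nr nc" by simp
  note RS = mult_carrier_mat[OF c(3) S] and TB = mult_carrier_mat[OF c(4) B]
  define V where "V = T * B * Q"
  have V: "V \<in> carrier_mat nc nc'" unfolding V_def by (rule mult_carrier_mat[OF TB c(2)])
  have PRS: "P * (R * ?S) \<in> carrier_mat nr nc" by (rule mult_carrier_mat[OF c(1) RS])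
  have "?S' = P * ((R * ?S) * (T * B)) * Q"
    unfolding PQ(3) RT(3) assoc_mult_mat[OF RS c(4) B] ..
  also have "\<dots> = (P * (R * ?S)) * V"
    unfolding V_def by (rule mult_mat_assoc4[OF c(1) RS TB c(2)])
  finally have S': "?S' = (P * R) * ?S * V" unfolding assoc_mult_mat[OF c(1) c(3) S] .
  have len: "length es \<le> nr" "length es \<le> nc" "length es' \<le> nr" "length es' \<le> nc'"
    using A AB unfolding smith_form_def by auto
  define M where "M = mat l nc' (\<lambda>(i,j). V $$ (i,j))"
  have M: "M \<in> carrier_mat l nc'" by (simp add: M_def)
  obtain v where v: "v \<in> carrier_vec nc'" "\<And>j. Suc l \<le> j \<Longrightarrow> j < nc' \<Longrightarrow> v $ j = 0"
    "M *\<^sub>v v = 0\<^sub>v l" "Gcd ((\<lambda>j. v $ j) ` {..<Suc l}) = 1"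
    using primitive_solution[OF M, of "Suc l"] l len by auto
  have Vv: "(V *\<^sub>v v) $ i = 0" if i: "i < l" for i
  proof -
    have "row M i = row V i" using i l len V by (intro eq_vecI) (auto simp: M_def)
    then have "(V *\<^sub>v v) $ i = (M *\<^sub>v v) $ i" using i l len V M by simp
    then show ?thesis using v(3) i by simp
  qed
  have Vvc: "V *\<^sub>v v \<in> carrier_vec nc" using V v(1) by (rule mult_mat_vec_carrier)
  have dS: "d dvd (?S *\<^sub>v (V *\<^sub>v v)) $ i" if i: "i < nr" for i
    using d[of i] Vv[of i] unfolding smith_diag_mult_vec[OF Vvc i len(2)] by (cases "i < l") auto
  have PR: "P * R \<in> carrier_mat nr nr" by (rule mult_carrier_mat[OF c(1,3)])
  have "?S' *\<^sub>v v = (P * R) *\<^sub>v (?S *\<^sub>v (V *\<^sub>v v))"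
    unfolding S' assoc_mult_mat_vec[OF mult_carrier_mat[OF PR S] V v(1)] assoc_mult_mat_vec[OF PR S Vvc] ..
  then have dS': "d dvd (?S' *\<^sub>v v) $ i" if i: "i < nr" for i
    using dvd_mult_mat_vec[OF PR mult_mat_vec_carrier[OF S Vvc] dS i] by simp
  \<comment> \<open>By the divisibility chain \<open>es' ! i\<close> may be replaced by its multiple
    \<open>es' ! l\<close>. All products then share one factor, and the gcd of the others is
    1.\<close>
  have "d dvd int (es' ! l) * v $ i" if i: "i < Suc l" for i
  proof -
    have "d dvd int (es' ! i) * v $ i"
      using dS'[of i] smith_diag_mult_vec[OF v(1), of i nr es'] i l len by simp
    moreover have "es' ! i dvd es' ! l"
      using AB i l sorted_wrt_nth_less[of "(dvd)" es' i l] unfolding smith_form_def by (cases "i = l") auto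
    ultimately show ?thesis by (meson dvd_trans int_dvd_int_iff mult_dvd_mono dvd_refl)
  qed
  then have "d dvd Gcd ((*) (int (es' ! l)) ` (\<lambda>j. v $ j) ` {..<Suc l})"
    by (intro Gcd_greatest) auto
  then show ?thesis using v(4) by (simp add: Gcd_mult del: Gcd_image_normalize)
qed

text \<open>Selecting columns is right multiplication by a 0-1 matrix, so this compares G with its
  column submatrices. The length bound uses 0 as common divisor, the divisibility uses
  \<open>es ! l\<close>, which divides all later entries.\<close>

lemma smith_form_mult:
  assumes A: "smith_form nr nc A es" and B: "B \<in> carrier_mat nc nc'" and AB: "smith_form nr nc' (A * B) es'"
  shows "length es' \<le> length es" and "\<And>l. l < length es' \<Longrightarrow> es ! l dvd es' ! l"
proof -
  show len: "length es' \<le> length es"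
  proof (rule ccontr)
    assume *: "\<not> length es' \<le> length es"
    \<comment> \<open>for \<open>l = length es\<close> the condition on d is vacuous\<close>
    then have "0 dvd int (es' ! length es)" by (intro smith_form_mult_dvd[OF A B AB]) auto
    moreover have "0 < es' ! length es"
      using AB * nth_mem[of "length es" es'] unfolding smith_form_def by simp
    ultimately show False by simp
  qed
  fix l assume l: "l < length es'"
  have "int (es ! l) dvd int (es' ! l)"
  proof (rule smith_form_mult_dvd[OF A B AB l])
    fix i assume "l \<le> i" "i < length es"
    then show "int (es ! l) dvd int (es ! i)"
      using A sorted_wrt_nth_less[of "(dvd)" es l i] unfolding smith_form_def by (cases "i = l") auto
  qed (use l len in simp)
  then show "es ! l dvd es' ! l" by simp
qed

section \<open>Counting kernels modulo q\<close>

definition vec_mod :: "nat \<Rightarrow> int vec \<Rightarrow> int vec" where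
  "vec_mod q v = map_vec (\<lambda>x. x mod int q) v"

lemma vec_mod_carrier [simp]: "vec_mod q v \<in> carrier_vec n \<longleftrightarrow> v \<in> carrier_vec n"
  by (auto simp: vec_mod_def)

lemma dim_vec_mod [simp]: "dim_vec (vec_mod q v) = dim_vec v"
  by (simp add: vec_mod_def)

lemma vec_mod_index: "i < dim_vec v \<Longrightarrow> vec_mod q v $ i = v $ i mod int q"
  by (simp add: vec_mod_def)

lemma vec_mod_zero [simp]: "vec_mod q (0\<^sub>v n) = 0\<^sub>v n"
  by (rule eq_vecI) (auto simp: vec_mod_index)

lemma vec_mod_eq_zero_iff:
  "v \<in> carrier_vec n \<Longrightarrow> vec_mod q v = 0\<^sub>v n \<longleftrightarrow> (\<forall>i<n. int q dvd v $ i)"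
  by (auto simp: vec_eq_iff vec_mod_index dvd_eq_mod_eq_0)

lemma zmod_vecs_iff:
  assumes "0 < q"
  shows "u \<in> zmod_vecs q k \<longleftrightarrow> u \<in> carrier_vec k \<and> vec_mod q u = u"
proof -
  have "x \<in> {0..<int q} \<longleftrightarrow> x mod int q = x" for x
  proof
    assume x: "x mod int q = x"
    have "0 \<le> x mod int q" "x mod int q < int q" using assms by simp_all
    then show "x \<in> {0..<int q}" unfolding x by simp
  qed (simp add: mod_pos_pos_trivial)
  then show ?thesis by (auto simp: zmod_vecs_def vec_eq_iff vec_mod_index)
qed

lemma vec_mod_in_zmod_vecs: "0 < q \<Longrightarrow> v \<in> carrier_vec k \<Longrightarrow> vec_mod q v \<in> zmod_vecs q k"
  by (auto simp: zmod_vecs_def vec_mod_index)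

lemma vec_mod_mult_mat:
  assumes "M \<in> carrier_mat nr nc" "v \<in> carrier_vec nc"
  shows "vec_mod q (M *\<^sub>v vec_mod q v) = vec_mod q (M *\<^sub>v v)"
proof (rule eq_vecI)
  fix i assume "i < dim_vec (vec_mod q (M *\<^sub>v v))"
  then have i: "i < nr" using assms by simp
  have "(\<Sum>l<nc. M $$ (i,l) * (v $ l mod int q)) mod int q = (\<Sum>l<nc. M $$ (i,l) * v $ l) mod int q"
    by (subst (1 2) mod_sum_eq[symmetric]) (simp add: mod_mult_right_eq)
  then show "vec_mod q (M *\<^sub>v vec_mod q v) $ i = vec_mod q (M *\<^sub>v v) $ i"
    using i assms by (simp add: vec_mod_index scalar_prod_def atLeast0LessThan)
qed (use assms in simp)

lemma vec_mod_mult_mat_eq_zero: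
  assumes "M \<in> carrier_mat nr nc" "v \<in> carrier_vec nc" "vec_mod q v = 0\<^sub>v nc"
  shows "vec_mod q (M *\<^sub>v v) = 0\<^sub>v nr"
proof -
  have "M *\<^sub>v 0\<^sub>v nc = 0\<^sub>v nr" using assms(1) by (intro eq_vecI) auto
  then show ?thesis using vec_mod_mult_mat[OF assms(1,2), of q] assms(3) by simp
qed

text \<open>After cancelling the gcd g from \<open>q = q' * g\<close> and e, the solutions are the
  multiples of q', of which g lie below q.\<close>

lemma card_residues_mult_dvd:
  assumes "0 < q"
  shows "card {x \<in> {0..<int q}. int q dvd int e * x} = gcd q e"
proof -
  define g where "g = gcd q e"
  have "g \<noteq> 0" using assms by (simp add: g_def)
  then obtain q' e' where qe: "q = q' * g" "e = e' * g" "coprime q' e'"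
    using gcd_coprime_exists[of q e] unfolding g_def by blast
  have pos: "0 < g" "0 < q'" using assms \<open>g \<noteq> 0\<close> unfolding qe(1) by simp_all
  have dvd: "int q dvd int e * x \<longleftrightarrow> int q' dvd x" for x
  proof -
    have "int q dvd int e * x \<longleftrightarrow> int g * int q' dvd int g * (int e' * x)"
      unfolding qe(1,2) by (simp add: ac_simps)
    also have "\<dots> \<longleftrightarrow> int q' dvd int e' * x" using pos by simp
    also have "\<dots> \<longleftrightarrow> int q' dvd x" using qe(3) by (simp add: coprime_dvd_mult_right_iff)
    finally show ?thesis .
  qed
  have "{x \<in> {0..<int q}. int q dvd int e * x} = (\<lambda>t. int q' * t) ` {0..<int g}"
  proof (intro equalityI subsetI)
    fix x assume x: "x \<in> {x \<in> {0..<int q}. int q dvd int e * x}"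
    then obtain t where t: "x = int q' * t" using dvd by (auto elim: dvdE)
    have "0 \<le> t" using x pos unfolding t by (simp add: zero_le_mult_iff)
    moreover have "int q' * t < int q' * int g" using x unfolding t qe(1) by (simp add: mult.commute)
    ultimately show "x \<in> (\<lambda>t. int q' * t) ` {0..<int g}" using pos unfolding t by simp
  next
    fix x assume "x \<in> (\<lambda>t. int q' * t) ` {0..<int g}"
    then obtain t where "t \<in> {0..<int g}" "x = int q' * t" by blast
    then have t: "x = int q' * t" "0 \<le> t" "t < int g" by simp_all
    have "int q' * t < int q' * int g" using t(3) pos by simp
    then have "x < int q" unfolding t(1) qe(1) by (simp add: mult.commute)
    then show "x \<in> {x \<in> {0..<int q}. int q dvd int e * x}"
      using t dvd by simp
  qed
  moreover have "inj_on (\<lambda>t. int q' * t) {0..<int g}" using pos by (auto simp: inj_on_def)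
  ultimately show ?thesis by (simp add: card_image g_def)
qed

text \<open>The conditions separate by coordinate, so the set corresponds to a product of the sets
  \<open>X i\<close>. Coordinates beyond the list are free and contribute a factor q each.\<close>

lemma card_diagonal_kernel:
  assumes q: "0 < q" and len: "length es \<le> nr"
  shows "card {w \<in> zmod_vecs q nr. \<forall>i<length es. int q dvd int (es ! i) * w $ i} =
    (\<Prod>l<length es. gcd q (es ! l)) * q ^ (nr - length es)"
proof -
  define X where "X i = (if i < length es then {x \<in> {0..<int q}. int q dvd int (es ! i) * x} else {0..<int q})" for i
  have "bij_betw (\<lambda>f. vec nr f) (PiE {..<nr} X) {w \<in> zmod_vecs q nr. \<forall>i<length es. int q dvd int (es ! i) * w $ i}"
  proof (rule bij_betw_byWitness[where f' = "\<lambda>w. \<lambda>i\<in>{..<nr}. w $ i"])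
    show "\<forall>f\<in>PiE {..<nr} X. (\<lambda>i\<in>{..<nr}. vec nr f $ i) = f"
      by (auto simp: fun_eq_iff restrict_def PiE_def extensional_def)
    show "\<forall>w\<in>{w \<in> zmod_vecs q nr. \<forall>i<length es. int q dvd int (es ! i) * w $ i}. vec nr (\<lambda>i\<in>{..<nr}. w $ i) = w"
      by (auto simp: zmod_vecs_def)
    show "vec nr ` PiE {..<nr} X \<subseteq> {w \<in> zmod_vecs q nr. \<forall>i<length es. int q dvd int (es ! i) * w $ i}"
    proof (intro image_subsetI CollectI conjI allI impI)
      fix f i assume f: "f \<in> PiE {..<nr} X"
      then have *: "f i \<in> X i" if "i < nr" for i using that by auto
      then have "f i \<in> {0..<int q}" if "i < nr" for i
        using *[OF that] unfolding X_def by (auto split: if_splits)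
      then show "vec nr f \<in> zmod_vecs q nr" by (auto simp: zmod_vecs_def)
      assume i: "i < length es"
      then show "int q dvd int (es ! i) * vec nr f $ i" using *[of i] len unfolding X_def by simp
    qed
    show "(\<lambda>w. \<lambda>i\<in>{..<nr}. w $ i) ` {w \<in> zmod_vecs q nr. \<forall>i<length es. int q dvd int (es ! i) * w $ i} \<subseteq> PiE {..<nr} X"
      by (auto simp: zmod_vecs_def X_def split: if_splits)
  qed
  from bij_betw_same_card[OF this]
  have "card {w \<in> zmod_vecs q nr. \<forall>i<length es. int q dvd int (es ! i) * w $ i} = card (PiE {..<nr} X)" ..
  also have "\<dots> = (\<Prod>i<nr. card (X i))" by (simp add: card_PiE)
  also have "\<dots> = (\<Prod>i<length es. card (X i)) * (\<Prod>i\<in>{length es..<nr}. card (X i))"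
    using len by (subst prod.union_disjoint[symmetric]) (auto intro!: prod.cong)
  also have "(\<Prod>i<length es. card (X i)) = (\<Prod>i<length es. gcd q (es ! i))"
    using card_residues_mult_dvd[OF q] by (intro prod.cong) (simp_all add: X_def)
  also have "(\<Prod>i\<in>{length es..<nr}. card (X i)) = q ^ (nr - length es)"
    by (simp add: X_def)
  finally show ?thesis .
qed

lemma inverse_pair_transpose:
  assumes "inverse_pair n P P'"
  shows "inverse_pair n (transpose_mat P) (transpose_mat P')"
proof -
  have c: "P \<in> carrier_mat n n" "P' \<in> carrier_mat n n" and inv: "P * P' = 1\<^sub>m n" "P' * P = 1\<^sub>m n"
    using assms unfolding inverse_pair_def by auto
  have "transpose_mat P * transpose_mat P' = 1\<^sub>m n"
    unfolding transpose_mult[OF c(2,1), symmetric] inv by simp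
  moreover have "transpose_mat P' * transpose_mat P = 1\<^sub>m n"
    unfolding transpose_mult[OF c(1,2), symmetric] inv by simp
  ultimately show ?thesis using c unfolding inverse_pair_def by simp
qed

text \<open>Transposing the Smith form writes the transpose of \<open>A\<close> as
  \<open>X * (D * Y)\<close>. The outer factor \<open>X\<close> is invertible and does not affect
  vanishing modulo q, and multiplication by \<open>Y\<close> permutes the residue vectors, so only
  the diagonal kernel has to be counted.\<close>

lemma smith_form_card_kernel:
  assumes A: "smith_form nr nc A es" and q: "0 < q"
  shows "card {u \<in> zmod_vecs q nr. vec_mod q (transpose_mat A *\<^sub>v u) = 0\<^sub>v nc} =
    (\<Prod>l<length es. gcd q (es ! l)) * q ^ (nr - length es)"
proof -
  let ?S = "smith_diag nr nc es"
  have len: "length es \<le> nr" "length es \<le> nc" using A unfolding smith_form_def by auto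
  obtain R R' T T' where RT: "inverse_pair nr R R'" "inverse_pair nc T T'" "A = R * ?S * T"
    using smith_equiv_sym[of nr nc A ?S] A unfolding smith_form_def smith_equiv_def by auto
  have c: "R \<in> carrier_mat nr nr" "T \<in> carrier_mat nc nc"
    using RT unfolding inverse_pair_def by auto
  have S: "?S \<in> carrier_mat nr nc" by simp
  define X X' Y Y' D where "X = transpose_mat T" and "X' = transpose_mat T'" and "Y = transpose_mat R"
    and "Y' = transpose_mat R'" and "D = transpose_mat ?S"
  note XY = X_def X'_def Y_def Y'_def D_def
  have D: "D = smith_diag nc nr es" unfolding XY by (rule eq_matI) (auto simp: smith_diag_index)
  have Dc: "D \<in> carrier_mat nc nr" unfolding D by simp
  have iX: "inverse_pair nc X X'" and iY: "inverse_pair nr Y Y'"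
    unfolding XY using RT inverse_pair_transpose by blast+
  then have XYc: "X \<in> carrier_mat nc nc" "X' \<in> carrier_mat nc nc" "Y \<in> carrier_mat nr nr" "Y' \<in> carrier_mat nr nr"
    and inv: "X' * X = 1\<^sub>m nc" "Y' * Y = 1\<^sub>m nr" "Y * Y' = 1\<^sub>m nr"
    unfolding inverse_pair_def by auto
  have At: "transpose_mat A = X * (D * Y)"
    unfolding RT(3) XY transpose_mult[OF mult_carrier_mat[OF c(1) S] c(2)] transpose_mult[OF c(1) S] ..
  have cancel: "vec_mod q (Z' *\<^sub>v vec_mod q (Z *\<^sub>v u)) = u"
    if "Z \<in> carrier_mat nr nr" "Z' \<in> carrier_mat nr nr" "Z' * Z = 1\<^sub>m nr" "u \<in> zmod_vecs q nr" for Z Z' u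
  proof -
    have u: "u \<in> carrier_vec nr" "vec_mod q u = u" using that(4) zmod_vecs_iff[OF q] by auto
    have "Z' *\<^sub>v (Z *\<^sub>v u) = u"
      unfolding assoc_mult_mat_vec[OF that(2,1) u(1), symmetric] that(3) using u(1) by simp
    then show ?thesis using vec_mod_mult_mat[OF that(2) mult_mat_vec_carrier[OF that(1) u(1)], of q] u(2) by simp
  qed
  have cond: "vec_mod q (transpose_mat A *\<^sub>v u) = 0\<^sub>v nc \<longleftrightarrow>
      (\<forall>i<length es. int q dvd int (es ! i) * vec_mod q (Y *\<^sub>v u) $ i)" if u: "u \<in> zmod_vecs q nr" for u
  proof -
    have uc: "u \<in> carrier_vec nr" using u zmod_vecs_iff[OF q] by auto
    have Yu: "Y *\<^sub>v u \<in> carrier_vec nr" by (rule mult_mat_vec_carrier[OF XYc(3) uc])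
    have DYu: "D *\<^sub>v (Y *\<^sub>v u) \<in> carrier_vec nc" by (rule mult_mat_vec_carrier[OF Dc Yu])
    have Au: "transpose_mat A *\<^sub>v u = X *\<^sub>v (D *\<^sub>v (Y *\<^sub>v u))"
      unfolding At assoc_mult_mat_vec[OF XYc(1) mult_carrier_mat[OF Dc XYc(3)] uc]
        assoc_mult_mat_vec[OF Dc XYc(3) uc] ..
    have X'X: "X' *\<^sub>v (X *\<^sub>v (D *\<^sub>v (Y *\<^sub>v u))) = D *\<^sub>v (Y *\<^sub>v u)"
      unfolding assoc_mult_mat_vec[OF XYc(2,1) DYu, symmetric] inv(1) using DYu by simp
    have "vec_mod q (transpose_mat A *\<^sub>v u) = 0\<^sub>v nc \<longleftrightarrow> vec_mod q (D *\<^sub>v (Y *\<^sub>v u)) = 0\<^sub>v nc"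
      unfolding Au using vec_mod_mult_mat_eq_zero[OF XYc(1) DYu]
        vec_mod_mult_mat_eq_zero[OF XYc(2) mult_mat_vec_carrier[OF XYc(1) DYu], unfolded X'X] by blast
    also have "vec_mod q (D *\<^sub>v (Y *\<^sub>v u)) = vec_mod q (D *\<^sub>v vec_mod q (Y *\<^sub>v u))"
      using vec_mod_mult_mat[OF Dc Yu] by simp
    also have "\<dots> = 0\<^sub>v nc \<longleftrightarrow> (\<forall>i<nc. int q dvd (D *\<^sub>v vec_mod q (Y *\<^sub>v u)) $ i)"
      by (rule vec_mod_eq_zero_iff) (use Dc Yu in \<open>auto intro: mult_mat_vec_carrier\<close>)
    also have "\<dots> \<longleftrightarrow> (\<forall>i<length es. int q dvd int (es ! i) * vec_mod q (Y *\<^sub>v u) $ i)"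
      unfolding D using smith_diag_mult_vec[of "vec_mod q (Y *\<^sub>v u)" nr _ nc es] Yu len by auto
    finally show ?thesis .
  qed
  have "bij_betw (\<lambda>u. vec_mod q (Y *\<^sub>v u)) {u \<in> zmod_vecs q nr. vec_mod q (transpose_mat A *\<^sub>v u) = 0\<^sub>v nc}
     {w \<in> zmod_vecs q nr. \<forall>i<length es. int q dvd int (es ! i) * w $ i}"
  proof (rule bij_betw_byWitness[where f' = "\<lambda>w. vec_mod q (Y' *\<^sub>v w)"])
    have mem: "vec_mod q (Z *\<^sub>v u) \<in> zmod_vecs q nr" if "Z \<in> carrier_mat nr nr" "u \<in> zmod_vecs q nr" for Z u
      using that vec_mod_in_zmod_vecs[OF q mult_mat_vec_carrier[OF that(1)]] zmod_vecs_iff[OF q] by auto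
    show "(\<lambda>u. vec_mod q (Y *\<^sub>v u)) ` {u \<in> zmod_vecs q nr. vec_mod q (transpose_mat A *\<^sub>v u) = 0\<^sub>v nc}
      \<subseteq> {w \<in> zmod_vecs q nr. \<forall>i<length es. int q dvd int (es ! i) * w $ i}"
      using cond mem[OF XYc(3)] by blast
    show "(\<lambda>w. vec_mod q (Y' *\<^sub>v w)) ` {w \<in> zmod_vecs q nr. \<forall>i<length es. int q dvd int (es ! i) * w $ i}
      \<subseteq> {u \<in> zmod_vecs q nr. vec_mod q (transpose_mat A *\<^sub>v u) = 0\<^sub>v nc}"
    proof (intro image_subsetI, elim CollectE conjE, intro CollectI conjI)
      fix w assume w: "w \<in> zmod_vecs q nr" "\<forall>i<length es. int q dvd int (es ! i) * w $ i"
      show m: "vec_mod q (Y' *\<^sub>v w) \<in> zmod_vecs q nr" by (rule mem[OF XYc(4) w(1)])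
      show "vec_mod q (transpose_mat A *\<^sub>v vec_mod q (Y' *\<^sub>v w)) = 0\<^sub>v nc"
        unfolding cond[OF m] cancel[OF XYc(4,3) inv(3) w(1)] by (rule w(2))
    qed
  qed (use cancel[OF XYc(3,4) inv(2)] cancel[OF XYc(4,3) inv(3)] in auto)
  from bij_betw_same_card[OF this] show ?thesis unfolding card_diagonal_kernel[OF q len(1)] .
qed

section \<open>Column submatrices\<close>

lemma pick_image:
  assumes "K \<subseteq> {0..<n}"
  shows "pick K ` {..<card K} = K"
proof (intro equalityI subsetI)
  fix j assume "j \<in> pick K ` {..<card K}"
  then show "j \<in> K" using pick_in_set_le by auto
next
  fix j assume j: "j \<in> K"
  \<comment> \<open>The number of elements of K below j is the position of j in the increasing
    enumeration \<open>pick K\<close>.\<close>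
  have "{a \<in> K. a < j} \<subset> K" using j by auto
  then have "card {a \<in> K. a < j} < card K"
    using assms by (intro psubset_card_mono) (auto intro: finite_subset)
  then show "j \<in> pick K ` {..<card K}"
    by (intro image_eqI[where x = "card {a \<in> K. a < j}"]) (simp_all add: pick_card_in_set[OF j])
qed

lemma submatrix_cols_carrier:
  assumes "A \<in> carrier_mat k n" "K \<subseteq> {0..<n}"
  shows "submatrix A UNIV K \<in> carrier_mat k (card K)"
proof -
  have "{j. j < n \<and> j \<in> K} = K" using assms(2) by auto
  then show ?thesis using assms(1) by (intro carrier_matI) (simp_all add: dim_submatrix)
qed

lemma submatrix_cols_index:
  assumes "A \<in> carrier_mat k n" "K \<subseteq> {0..<n}" "i < k" "j < card K"
  shows "submatrix A UNIV K $$ (i,j) = A $$ (i, pick K j)"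
proof -
  have "{j. j < n \<and> j \<in> K} = K" using assms(2) by auto
  then show ?thesis using assms by (subst submatrix_index) (simp_all add: pick_UNIV)
qed

lemma submatrix_all_cols:
  assumes "A \<in> carrier_mat k n"
  shows "submatrix A UNIV {0..<n} = A"
proof (rule eq_matI)
  fix i j assume ij: "i < dim_row A" "j < dim_col A"
  have "{a \<in> {0..<n}. a < j} = {0..<j}" using ij assms by auto
  then have "pick {0..<n} j = j" using pick_card_in_set[of j "{0..<n}"] ij assms by simp
  then show "submatrix A UNIV {0..<n} $$ (i,j) = A $$ (i,j)"
    using submatrix_cols_index[OF assms order_refl, of i j] ij assms by simp
qed (use submatrix_cols_carrier[OF assms order_refl] assms in auto)

lemma submatrix_cols_eq_mult:
  fixes A :: "'a :: semiring_1 mat"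
  assumes A: "A \<in> carrier_mat k n" and K: "K \<subseteq> {0..<n}"
  obtains B where "B \<in> carrier_mat n (card K)" "submatrix A UNIV K = A * B"
proof
  let ?B = "mat n (card K) (\<lambda>(l,j). if l = pick K j then 1 else 0)"
  show "?B \<in> carrier_mat n (card K)" by simp
  show "submatrix A UNIV K = A * ?B"
  proof (rule eq_matI)
    fix i j assume "i < dim_row (A * ?B)" "j < dim_col (A * ?B)"
    then have ij: "i < k" "j < card K" using A by auto
    have pn: "pick K j < n" using pick_in_set_le[OF ij(2)] K by auto
    have "(A * ?B) $$ (i,j) = (\<Sum>l<n. A $$ (i,l) * (if l = pick K j then 1 else 0))"
      using ij A by (simp add: scalar_prod_def atLeast0LessThan)
    also have "\<dots> = (\<Sum>l<n. if l = pick K j then A $$ (i,l) else 0)" by (intro sum.cong) auto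
    also have "\<dots> = A $$ (i, pick K j)" using pn by (simp add: sum.delta)
    finally show "submatrix A UNIV K $$ (i,j) = (A * ?B) $$ (i,j)"
      using submatrix_cols_index[OF A K ij] by simp
  qed (use submatrix_cols_carrier[OF A K] A in auto)
qed

section \<open>Alternating sums over intervals of subsets\<close>

lemma alternating_sum_Pow:
  assumes "finite S"
  shows "(\<Sum>T\<in>Pow S. (-1) ^ card T) = (if S = {} then 1 else 0 :: 'a :: comm_ring_1)"
  using assms
proof (induction S)
  case (insert x S)
  have "(\<Sum>T\<in>Pow (insert x S). (-1) ^ card T) =
      (\<Sum>T\<in>Pow S. (-1) ^ card T) + (\<Sum>T\<in>insert x ` Pow S. (-1) ^ card T :: 'a)"
    unfolding Pow_insert using insert.hyps by (intro sum.union_disjoint) auto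
  also have "(\<Sum>T\<in>insert x ` Pow S. (-1) ^ card T :: 'a) = (\<Sum>T\<in>Pow S. (-1) ^ card (insert x T))"
    using insert.hyps by (subst sum.reindex) (auto simp: inj_on_def)
  also have "\<dots> = (\<Sum>T\<in>Pow S. - ((-1) ^ card T))"
  proof (rule sum.cong)
    fix T assume "T \<in> Pow S"
    then have "finite T" "x \<notin> T" using insert.hyps by (auto intro: finite_subset)
    then show "(-1 :: 'a) ^ card (insert x T) = - ((-1) ^ card T)" by simp
  qed simp
  finally show ?case by (simp add: sum_negf)
qed simp

text \<open>Writing K as the disjoint union of J and T with \<open>T \<subseteq> E - J\<close>
  reduces the interval to a full power set. This is Moebius inversion on the subset lattice.\<close>

lemma alternating_sum_interval:
  assumes "finite E" "J \<subseteq> E"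
  shows "(\<Sum>K\<in>{K. J \<subseteq> K \<and> K \<subseteq> E}. (-1) ^ (card K - card J)) = (if E = J then 1 else 0 :: 'a :: comm_ring_1)"
proof -
  have fin: "finite J" using assms finite_subset by blast
  have "{K. J \<subseteq> K \<and> K \<subseteq> E} = (\<lambda>T. J \<union> T) ` Pow (E - J)"
  proof (intro equalityI subsetI)
    fix K assume "K \<in> {K. J \<subseteq> K \<and> K \<subseteq> E}"
    then show "K \<in> (\<lambda>T. J \<union> T) ` Pow (E - J)" by (intro image_eqI[of _ _ "K - J"]) auto
  qed (use assms in auto)
  moreover have "inj_on (\<lambda>T. J \<union> T) (Pow (E - J))" by (auto simp: inj_on_def)
  ultimately have "(\<Sum>K\<in>{K. J \<subseteq> K \<and> K \<subseteq> E}. (-1) ^ (card K - card J)) =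
      (\<Sum>T\<in>Pow (E - J). (-1) ^ (card (J \<union> T) - card J) :: 'a)" by (simp add: sum.reindex)
  also have "\<dots> = (\<Sum>T\<in>Pow (E - J). (-1) ^ card T)"
  proof (rule sum.cong)
    fix T assume "T \<in> Pow (E - J)"
    then have "card (J \<union> T) = card J + card T"
      using fin assms by (intro card_Un_disjoint) (auto intro: finite_subset)
    then show "(-1 :: 'a) ^ (card (J \<union> T) - card J) = (-1) ^ card T" by simp
  qed simp
  finally show ?thesis using alternating_sum_Pow[of "E - J"] assms by auto
qed

section \<open>Codewords with prescribed zeros\<close>

locale integer_code =
  fixes G :: "int mat" and k n :: nat
  assumes G: "G \<in> carrier_mat k n"
begin

abbreviation "E \<equiv> {0..<n}"

definition divisors :: "nat set \<Rightarrow> nat list" where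
  "divisors K = elementary_divisors (submatrix G UNIV K)"

definition gcd_prod :: "nat \<Rightarrow> nat set \<Rightarrow> nat" where
  "gcd_prod m K = (\<Prod>l=1..col_rank G K. gcd m (elem_div G K l))"

text \<open>A set of messages, since these are what the Smith form counts; \<open>kernel q E\<close>
  consists of the messages sent to the zero codeword.\<close>

definition kernel :: "nat \<Rightarrow> nat set \<Rightarrow> int vec set" where
  "kernel q K = {u \<in> zmod_vecs q k. \<forall>j\<in>K. int q dvd (transpose_mat G *\<^sub>v u) $ j}"

definition codeword :: "nat \<Rightarrow> int vec \<Rightarrow> int vec" where
  "codeword q u = vec_mod q (transpose_mat G *\<^sub>v u)"

definition zero_set :: "int vec \<Rightarrow> nat set" where
  "zero_set c = {j \<in> E. c $ j = 0}"

lemma ground_eq: "ground G = E"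
  using G by (simp add: ground_def)

lemma divisors_smith_form:
  assumes "K \<subseteq> E"
  shows "smith_form k (card K) (submatrix G UNIV K) (divisors K)"
  unfolding divisors_def by (rule elementary_divisors_smith_form[OF submatrix_cols_carrier[OF G assms]])

lemma length_divisors:
  assumes "K \<subseteq> E"
  shows "length (divisors K) = col_rank G K"
  unfolding divisors_def col_rank_def
  by (rule length_elementary_divisors[OF submatrix_cols_carrier[OF G assms]])

lemma col_rank_le:
  assumes "K \<subseteq> E"
  shows "col_rank G K \<le> k" "col_rank G K \<le> card K"
  using divisors_smith_form[OF assms] length_divisors[OF assms] unfolding smith_form_def by auto

lemma divisors_E: "smith_form k n G (divisors E)"
  using divisors_smith_form[OF order_refl] submatrix_all_cols[OF G] by simp

lemma col_rank_le_E:
  assumes "K \<subseteq> E"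
  shows "col_rank G K \<le> col_rank G E"
proof -
  obtain B where B: "B \<in> carrier_mat n (card K)" "submatrix G UNIV K = G * B"
    using submatrix_cols_eq_mult[OF G assms] .
  show ?thesis
    using smith_form_mult(1)[OF divisors_E B(1) divisors_smith_form[OF assms, unfolded B(2)]]
      length_divisors assms by simp
qed

lemma elem_div_E_dvd:
  assumes K: "K \<subseteq> E" and l: "l \<in> {1..col_rank G K}"
  shows "elem_div G E l dvd elem_div G K l"
proof -
  obtain B where B: "B \<in> carrier_mat n (card K)" "submatrix G UNIV K = G * B"
    using submatrix_cols_eq_mult[OF G K] .
  have "l - 1 < length (divisors K)" using l length_divisors[OF K] by auto
  then have "divisors E ! (l - 1) dvd divisors K ! (l - 1)"
    by (rule smith_form_mult(2)[OF divisors_E B(1) divisors_smith_form[OF K, unfolded B(2)]])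
  then show ?thesis unfolding elem_div_def divisors_def .
qed

text \<open>The divisibility chain leads to the last elementary divisor of K, which is one of the
  terms of the lcm. K is nonempty because its rank is at least l.\<close>

lemma elem_div_dvd_lcm_period:
  assumes K: "K \<subseteq> E" and l: "l \<in> {1..col_rank G K}"
  shows "elem_div G K l dvd lcm_period G"
proof -
  have len: "col_rank G K - 1 < length (divisors K)" using l length_divisors[OF K] by auto
  have "divisors K ! (l - 1) dvd divisors K ! (col_rank G K - 1)"
  proof (cases "l = col_rank G K")
    case False
    then show ?thesis using divisors_smith_form[OF K] len l unfolding smith_form_def
      by (intro sorted_wrt_nth_less[of "(dvd)"]) auto
  qed simp
  then have "elem_div G K l dvd elem_div G K (col_rank G K)" unfolding elem_div_def divisors_def .
  also have "K \<noteq> {}" using l col_rank_le(2)[OF K] by auto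
  then have "elem_div G K (col_rank G K) dvd lcm_period G"
    unfolding lcm_period_def ground_eq using K by (intro dvd_Lcm) auto
  finally show ?thesis .
qed

lemma gcd_prod_pos:
  assumes "0 < m"
  shows "0 < gcd_prod m K"
  unfolding gcd_prod_def using assms by (intro prod_pos) simp

text \<open>Every elementary divisor divides the period, so intersecting q with the period first
  loses nothing. This is why the counts are polynomial in q along a fixed value of
  \<open>gcd q (lcm_period G)\<close>.\<close>

lemma gcd_prod_gcd:
  assumes "K \<subseteq> E"
  shows "gcd_prod (gcd q (lcm_period G)) K = gcd_prod q K"
  unfolding gcd_prod_def
proof (rule prod.cong)
  fix l assume "l \<in> {1..col_rank G K}"
  then have "gcd (lcm_period G) (elem_div G K l) = elem_div G K l"
    using elem_div_dvd_lcm_period[OF assms] by (simp add: gcd_nat.absorb2)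
  then show "gcd (gcd q (lcm_period G)) (elem_div G K l) = gcd q (elem_div G K l)"
    by (simp add: gcd.assoc)
qed simp

lemma kernel_iff:
  assumes "K \<subseteq> E"
  shows "kernel q K = {u \<in> zmod_vecs q k. vec_mod q (transpose_mat (submatrix G UNIV K) *\<^sub>v u) = 0\<^sub>v (card K)}"
proof -
  let ?S = "submatrix G UNIV K"
  have S: "?S \<in> carrier_mat k (card K)" by (rule submatrix_cols_carrier[OF G assms])
  have "vec_mod q (transpose_mat ?S *\<^sub>v u) = 0\<^sub>v (card K) \<longleftrightarrow>
      (\<forall>j\<in>K. int q dvd (transpose_mat G *\<^sub>v u) $ j)" if u: "u \<in> zmod_vecs q k" for u
  proof -
    have uc: "u \<in> carrier_vec k" using u unfolding zmod_vecs_def by simp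
    have "(transpose_mat ?S *\<^sub>v u) $ j = (transpose_mat G *\<^sub>v u) $ pick K j" if j: "j < card K" for j
    proof -
      have "pick K j < n" using pick_in_set_le[OF j] assms by auto
      moreover from this have "col ?S j = col G (pick K j)"
        using S G j submatrix_cols_index[OF G assms _ j] by (intro eq_vecI) auto
      ultimately show ?thesis using S G j by simp
    qed
    then have "vec_mod q (transpose_mat ?S *\<^sub>v u) = 0\<^sub>v (card K) \<longleftrightarrow>
      (\<forall>j\<in>{..<card K}. int q dvd (transpose_mat G *\<^sub>v u) $ pick K j)"
      using mult_mat_vec_carrier[of "transpose_mat ?S" "card K" k u] uc S
      by (subst vec_mod_eq_zero_iff) (auto simp del: index_mult_mat_vec)
    also have "\<dots> \<longleftrightarrow> (\<forall>j\<in>pick K ` {..<card K}. int q dvd (transpose_mat G *\<^sub>v u) $ j)" by blast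
    finally show ?thesis unfolding pick_image[OF assms] .
  qed
  then show ?thesis unfolding kernel_def by blast
qed

lemma card_kernel:
  assumes K: "K \<subseteq> E" and q: "0 < q"
  shows "card (kernel q K) = gcd_prod q K * q ^ (k - col_rank G K)"
proof -
  have "gcd_prod q K = (\<Prod>l<length (divisors K). gcd q (divisors K ! l))"
    unfolding gcd_prod_def length_divisors[OF K] One_nat_def prod.atLeast1_atMost_eq
    by (simp add: elem_div_def divisors_def)
  then show ?thesis
    unfolding kernel_iff[OF K] smith_form_card_kernel[OF divisors_smith_form[OF K] q]
    by (simp add: length_divisors[OF K])
qed

lemma code_eq: "code G q = codeword q ` zmod_vecs q k"
  using G unfolding code_def codeword_def vec_mod_def by simp

lemma Gt_carrier: "transpose_mat G \<in> carrier_mat n k"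
  using G by simp

lemma codeword_carrier: "u \<in> carrier_vec k \<Longrightarrow> codeword q u \<in> carrier_vec n"
  unfolding codeword_def using mult_mat_vec_carrier[OF Gt_carrier] by simp

lemma codeword_vec_mod:
  "u \<in> carrier_vec k \<Longrightarrow> codeword q (vec_mod q u) = codeword q u"
  unfolding codeword_def by (rule vec_mod_mult_mat[OF Gt_carrier])

lemma finite_zmod_vecs:
  assumes "0 < q"
  shows "finite (zmod_vecs q k)"
proof -
  have "card {w \<in> zmod_vecs q k. \<forall>i<length []. int q dvd int ([] ! i) * w $ i} = q ^ k"
    using card_diagonal_kernel[OF assms, of "[]" k] by simp
  then show ?thesis using assms by (intro card_ge_0_finite) simp
qed

lemma finite_code: "0 < q \<Longrightarrow> finite (code G q)"
  unfolding code_eq using finite_zmod_vecs by blast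

lemma code_carrier: "c \<in> code G q \<Longrightarrow> c \<in> carrier_vec n"
  unfolding code_eq zmod_vecs_def using codeword_carrier by auto

lemma codeword_index_eq_0_iff:
  assumes "u \<in> carrier_vec k" "j < n"
  shows "codeword q u $ j = 0 \<longleftrightarrow> int q dvd (transpose_mat G *\<^sub>v u) $ j"
proof -
  have "dim_vec (transpose_mat G *\<^sub>v u) = n" using Gt_carrier by simp
  then show ?thesis using assms(2) unfolding codeword_def by (simp only: vec_mod_index dvd_eq_mod_eq_0)
qed

text \<open>Translation by a preimage identifies every fibre of \<^term>\<open>codeword q\<close> with the kernel.\<close>

lemma card_codeword_fibre:
  assumes q: "0 < q" and u0: "u0 \<in> zmod_vecs q k"
  shows "card {u \<in> zmod_vecs q k. codeword q u = codeword q u0} = card (kernel q E)"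
proof -
  have u0c: "u0 \<in> carrier_vec k" using u0 zmod_vecs_iff[OF q] by simp
  have idx: "codeword q u $ j = (transpose_mat G *\<^sub>v u) $ j mod int q" if "j < n" for u j
    using that Gt_carrier unfolding codeword_def by (subst vec_mod_index) auto
  have cong: "codeword q u = codeword q u' \<longleftrightarrow>
      (\<forall>j<n. int q dvd (transpose_mat G *\<^sub>v u) $ j - (transpose_mat G *\<^sub>v u') $ j)"
    if "u \<in> carrier_vec k" "u' \<in> carrier_vec k" for u u'
  proof -
    have "codeword q u = codeword q u' \<longleftrightarrow> (\<forall>j<n. codeword q u $ j = codeword q u' $ j)"
      using carrier_vecD[OF codeword_carrier[OF that(1), of q]] carrier_vecD[OF codeword_carrier[OF that(2), of q]]
      by (auto simp: vec_eq_iff)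
    then show ?thesis by (simp add: idx mod_eq_dvd_iff del: index_mult_mat_vec)
  qed
  have ker: "u \<in> kernel q E \<longleftrightarrow> u \<in> zmod_vecs q k \<and> (\<forall>j<n. int q dvd (transpose_mat G *\<^sub>v u) $ j)" for u
    unfolding kernel_def by auto
  have minus: "(transpose_mat G *\<^sub>v (u - u0)) $ j = (transpose_mat G *\<^sub>v u) $ j - (transpose_mat G *\<^sub>v u0) $ j"
    and plus: "(transpose_mat G *\<^sub>v (u + u0)) $ j = (transpose_mat G *\<^sub>v u) $ j + (transpose_mat G *\<^sub>v u0) $ j"
    if "u \<in> carrier_vec k" "j < n" for u j
    unfolding mult_minus_distrib_mat_vec[OF Gt_carrier that(1) u0c] mult_add_distrib_mat_vec[OF Gt_carrier that(1) u0c]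
    using that Gt_carrier by simp_all
  have dvd_mod: "int q dvd (transpose_mat G *\<^sub>v vec_mod q v) $ j \<longleftrightarrow> int q dvd (transpose_mat G *\<^sub>v v) $ j"
    if "v \<in> carrier_vec k" "j < n" for v j
    using codeword_index_eq_0_iff[of "vec_mod q v" j q] codeword_index_eq_0_iff[of v j q] that
    by (simp add: codeword_vec_mod)
  have "bij_betw (\<lambda>u. vec_mod q (u - u0)) {u \<in> zmod_vecs q k. codeword q u = codeword q u0} (kernel q E)"
  proof (rule bij_betw_byWitness[where f' = "\<lambda>u. vec_mod q (u + u0)"])
    show "\<forall>u\<in>{u \<in> zmod_vecs q k. codeword q u = codeword q u0}. vec_mod q (vec_mod q (u - u0) + u0) = u"
    proof (intro ballI, elim CollectE conjE)
      fix u assume "u \<in> zmod_vecs q k"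
      then have u: "u \<in> carrier_vec k" "vec_mod q u = u" using zmod_vecs_iff[OF q] by auto
      have "vec_mod q (vec_mod q (u - u0) + u0) = vec_mod q u"
        using u(1) u0c by (intro eq_vecI) (auto simp: vec_mod_index mod_add_left_eq)
      then show "vec_mod q (vec_mod q (u - u0) + u0) = u" using u by simp
    qed
    show "\<forall>u\<in>kernel q E. vec_mod q (vec_mod q (u + u0) - u0) = u"
    proof
      fix u assume "u \<in> kernel q E"
      then have u: "u \<in> carrier_vec k" "vec_mod q u = u" using zmod_vecs_iff[OF q] unfolding kernel_def by auto
      have "vec_mod q (vec_mod q (u + u0) - u0) = vec_mod q u"
        using u(1) u0c by (intro eq_vecI) (auto simp: vec_mod_index mod_diff_left_eq)
      then show "vec_mod q (vec_mod q (u + u0) - u0) = u" using u by simp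
    qed
    show "(\<lambda>u. vec_mod q (u - u0)) ` {u \<in> zmod_vecs q k. codeword q u = codeword q u0} \<subseteq> kernel q E"
    proof (intro image_subsetI, elim CollectE conjE)
      fix u assume u: "u \<in> zmod_vecs q k" and eq: "codeword q u = codeword q u0"
      have uc: "u \<in> carrier_vec k" using u zmod_vecs_iff[OF q] by simp
      have uu: "u - u0 \<in> carrier_vec k" using uc u0c by simp
      show "vec_mod q (u - u0) \<in> kernel q E"
        unfolding ker using vec_mod_in_zmod_vecs[OF q uu] dvd_mod[OF uu] minus[OF uc] eq[unfolded cong[OF uc u0c]] by simp
    qed
    show "(\<lambda>u. vec_mod q (u + u0)) ` kernel q E \<subseteq> {u \<in> zmod_vecs q k. codeword q u = codeword q u0}"
    proof (intro image_subsetI CollectI conjI)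
      fix u assume u: "u \<in> kernel q E"
      then have uc: "u \<in> carrier_vec k" using zmod_vecs_iff[OF q] unfolding kernel_def by simp
      have uu: "u + u0 \<in> carrier_vec k" using uc u0c by simp
      show "vec_mod q (u + u0) \<in> zmod_vecs q k" by (rule vec_mod_in_zmod_vecs[OF q uu])
      have "codeword q (u + u0) = codeword q u0"
        unfolding cong[OF uu u0c] using plus[OF uc] u[unfolded ker] by simp
      then show "codeword q (vec_mod q (u + u0)) = codeword q u0" using codeword_vec_mod[OF uu] by simp
    qed
  qed
  then show ?thesis by (rule bij_betw_same_card)
qed

section \<open>Counting codewords by their zero sets\<close>

definition vanishing :: "nat \<Rightarrow> nat set \<Rightarrow> int vec set" where
  "vanishing q K = {c \<in> code G q. K \<subseteq> zero_set c}"

lemma vanishing_eq: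
  assumes "K \<subseteq> E"
  shows "vanishing q K = codeword q ` kernel q K"
proof -
  have "K \<subseteq> zero_set (codeword q u) \<longleftrightarrow> (\<forall>j\<in>K. int q dvd (transpose_mat G *\<^sub>v u) $ j)"
    if "u \<in> zmod_vecs q k" for u
    using that assms codeword_index_eq_0_iff[of u _ q] unfolding zmod_vecs_def zero_set_def by auto
  then show ?thesis unfolding vanishing_def code_eq kernel_def by auto
qed

text \<open>Membership in \<open>kernel q K\<close> depends only on the codeword, so
  \<open>kernel q K\<close> is a union of full fibres, all of the size of \<open>kernel q E\<close>.
  The product form avoids division of natural numbers.\<close>

lemma card_vanishing_mult:
  assumes K: "K \<subseteq> E" and q: "0 < q"
  shows "card (vanishing q K) * card (kernel q E) = card (kernel q K)"
proof -
  have fin: "finite (kernel q K)" using finite_zmod_vecs[OF q] unfolding kernel_def by simp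
  have "card (kernel q K) = (\<Sum>c\<in>vanishing q K. card {u \<in> kernel q K. codeword q u = c})"
    using sum.image_gen[OF fin, of "\<lambda>_. 1 :: nat" "codeword q"] unfolding vanishing_eq[OF K] by simp
  also have "\<dots> = (\<Sum>c\<in>vanishing q K. card (kernel q E))"
  proof (rule sum.cong)
    fix c assume "c \<in> vanishing q K"
    then obtain u0 where u0: "u0 \<in> kernel q K" "c = codeword q u0" unfolding vanishing_eq[OF K] by blast
    have "u \<in> kernel q K" if u: "u \<in> zmod_vecs q k" "codeword q u = c" for u
    proof -
      have uc: "u \<in> carrier_vec k" "u0 \<in> carrier_vec k"
        using u u0 unfolding kernel_def zmod_vecs_def by auto
      have "int q dvd (transpose_mat G *\<^sub>v u) $ j" if j: "j \<in> K" for j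
      proof -
        have jn: "j < n" using j K by auto
        have "int q dvd (transpose_mat G *\<^sub>v u0) $ j" using u0(1) j unfolding kernel_def by blast
        then show ?thesis
          unfolding codeword_index_eq_0_iff[OF uc(1) jn, symmetric] codeword_index_eq_0_iff[OF uc(2) jn, symmetric]
          by (simp only: u(2) u0(2))
      qed
      then show ?thesis using u unfolding kernel_def by simp
    qed
    then have "{u \<in> kernel q K. codeword q u = c} = {u \<in> zmod_vecs q k. codeword q u = codeword q u0}"
      using u0 unfolding kernel_def by blast
    then show "card {u \<in> kernel q K. codeword q u = c} = card (kernel q E)"
      using card_codeword_fibre[OF q, of u0] u0 unfolding kernel_def by simp
  qed simp
  finally show ?thesis by simp
qed

definition ratio :: "nat \<Rightarrow> nat set \<Rightarrow> rat" where
  "ratio m K = of_nat (gcd_prod m K) / of_nat (gcd_prod m E)"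

lemma card_vanishing:
  assumes K: "K \<subseteq> E" and q: "0 < q"
  shows "rat_of_nat (card (vanishing q K)) = ratio q K * of_nat q ^ (col_rank G E - col_rank G K)"
proof -
  let ?r = "col_rank G E" and ?s = "col_rank G K"
  have "?s \<le> ?r" "?r \<le> k" using col_rank_le_E[OF K] col_rank_le(1)[OF order_refl] by auto
  \<comment> \<open>The bounds make these truncated subtractions exact; the power with exponent
    \<open>k - ?r\<close> is common to both kernels and cancels.\<close>
  then have "k - ?s = (?r - ?s) + (k - ?r)" by simp
  then have "card (vanishing q K) * gcd_prod q E * q ^ (k - ?r) = gcd_prod q K * q ^ (?r - ?s) * q ^ (k - ?r)"
    using card_vanishing_mult[OF K q] unfolding card_kernel[OF K q] card_kernel[OF order_refl q]
    by (simp add: power_add mult.assoc)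
  then have "card (vanishing q K) * gcd_prod q E = gcd_prod q K * q ^ (?r - ?s)" using q by simp
  then have "rat_of_nat (card (vanishing q K)) * of_nat (gcd_prod q E) = of_nat (gcd_prod q K) * of_nat q ^ (?r - ?s)"
    by (metis of_nat_mult of_nat_power)
  then show ?thesis using gcd_prod_pos[OF q, of E] unfolding ratio_def by (simp add: field_simps)
qed

definition exact :: "nat \<Rightarrow> nat set \<Rightarrow> int vec set" where
  "exact q J = {c \<in> code G q. zero_set c = J}"

text \<open>This is \<open>g\<^sub>J\<close> of the overview, the inner sum of the weight
  polynomial.\<close>

definition cell_poly :: "nat \<Rightarrow> nat set \<Rightarrow> rat poly" where
  "cell_poly m J = (\<Sum>K\<in>{K. J \<subseteq> K \<and> K \<subseteq> E}.
     monom ((-1) ^ (card K - card J) * ratio m K) (col_rank G E - col_rank G K))"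

lemma zero_set_subset: "zero_set c \<subseteq> E"
  unfolding zero_set_def by auto

lemma finite_interval: "finite {K. J \<subseteq> K \<and> K \<subseteq> E}"
  by (rule finite_subset[of _ "Pow E"]) auto

lemma card_vanishing_eq_sum:
  assumes q: "0 < q"
  shows "card (vanishing q J) = (\<Sum>K\<in>{K. J \<subseteq> K \<and> K \<subseteq> E}. card (exact q K))"
proof -
  have "vanishing q J = (\<Union>K\<in>{K. J \<subseteq> K \<and> K \<subseteq> E}. exact q K)"
    unfolding vanishing_def exact_def using zero_set_subset by auto
  moreover have "card (\<Union>K\<in>{K. J \<subseteq> K \<and> K \<subseteq> E}. exact q K) = (\<Sum>K\<in>{K. J \<subseteq> K \<and> K \<subseteq> E}. card (exact q K))"
    by (rule card_UN_disjoint[OF finite_interval]) (use finite_code[OF q] in \<open>auto simp: exact_def\<close>)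
  ultimately show ?thesis by simp
qed

text \<open>Expanding each cardinality over the codewords and exchanging the sums leaves, for a
  codeword c, an alternating sum over the interval from J to \<open>zero_set c\<close>, which is 1
  if the two sets agree and 0 otherwise.\<close>

lemma card_exact:
  assumes q: "0 < q"
  shows "rat_of_nat (card (exact q J)) =
    (\<Sum>K\<in>{K. J \<subseteq> K \<and> K \<subseteq> E}. (-1) ^ (card K - card J) * of_nat (card (vanishing q K)))"
proof -
  let ?I = "{K. J \<subseteq> K \<and> K \<subseteq> E}"
  note fin = finite_code[OF q]
  have count: "rat_of_nat (card {c \<in> code G q. P c}) = (\<Sum>c\<in>code G q. if P c then 1 else 0)" for P
    using fin by (simp add: sum.If_cases Int_def)
  have "(\<Sum>K\<in>?I. (-1) ^ (card K - card J) * of_nat (card (vanishing q K))) =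
      (\<Sum>K\<in>?I. \<Sum>c\<in>code G q. if K \<subseteq> zero_set c then (-1) ^ (card K - card J) else 0 :: rat)"
    unfolding vanishing_def count sum_distrib_left by (intro sum.cong) auto
  also have "\<dots> = (\<Sum>c\<in>code G q. \<Sum>K\<in>?I. if K \<subseteq> zero_set c then (-1) ^ (card K - card J) else 0)"
    by (rule sum.swap)
  also have "\<dots> = (\<Sum>c\<in>code G q. if zero_set c = J then 1 else 0)"
  proof (rule sum.cong)
    fix c assume "c \<in> code G q"
    have Z: "zero_set c \<subseteq> E" by (rule zero_set_subset)
    have "(\<Sum>K\<in>?I. if K \<subseteq> zero_set c then (-1) ^ (card K - card J) else 0) =
        (\<Sum>K\<in>{K. J \<subseteq> K \<and> K \<subseteq> zero_set c}. (-1) ^ (card K - card J) :: rat)"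
      using Z finite_interval by (intro sum.mono_neutral_cong_right) auto
    also have "\<dots> = (if zero_set c = J then 1 else 0)"
    proof (cases "J \<subseteq> zero_set c")
      case True
      then show ?thesis using alternating_sum_interval[of "zero_set c" J] Z finite_subset[OF Z] by simp
    next
      case False
      then have "{K. J \<subseteq> K \<and> K \<subseteq> zero_set c} = {}" "zero_set c \<noteq> J" by auto
      then show ?thesis by (simp only: sum.empty if_False)
    qed
    finally show "(\<Sum>K\<in>?I. if K \<subseteq> zero_set c then (-1) ^ (card K - card J) else 0) =
      (if zero_set c = J then 1 else 0 :: rat)" .
  qed simp
  also have "\<dots> = rat_of_nat (card (exact q J))" unfolding exact_def count ..
  finally show ?thesis by simp
qed

text \<open>The coefficients are formed with m and the counts with q; the ratios agree because gcd
  products see q only through its gcd with the period.\<close>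

lemma poly_cell_poly:
  assumes q: "0 < q" and m: "gcd q (lcm_period G) = m"
  shows "poly (cell_poly m J) (of_nat q) = of_nat (card (exact q J))"
proof -
  have "ratio m K = ratio q K" if "K \<subseteq> E" for K
    unfolding ratio_def m[symmetric] gcd_prod_gcd[OF that] gcd_prod_gcd[OF order_refl] ..
  then show ?thesis
    unfolding cell_poly_def poly_sum poly_monom card_exact[OF q]
    by (intro sum.cong) (simp_all add: card_vanishing[OF _ q] mult.assoc)
qed

lemma weight_poly_eq:
  "weight_poly G m i = (\<Sum>J\<in>{J. J \<subseteq> E \<and> card J = n - i}. cell_poly m J)"
  unfolding weight_poly_def cell_poly_def ratio_def gcd_prod_def ground_eq carrier_matD(2)[OF G] ..

section \<open>Column rank through spanning families\<close>

lemma col_rank_leI: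
  assumes K: "K \<subseteq> E" and B: "B \<in> carrier_mat k s"
    and col: "\<And>j. j \<in> K \<Longrightarrow> \<exists>x \<in> carrier_vec s. map_vec rat_of_int (col G j) = B *\<^sub>v x"
  shows "col_rank G K \<le> s"
proof -
  let ?S = "submatrix G UNIV K"
  have S: "?S \<in> carrier_mat k (card K)" by (rule submatrix_cols_carrier[OF G K])
  obtain x where x: "\<And>j. j \<in> K \<Longrightarrow> x j \<in> carrier_vec s \<and> map_vec rat_of_int (col G j) = B *\<^sub>v x j"
    using bchoice[of K "\<lambda>j x. x \<in> carrier_vec s \<and> map_vec rat_of_int (col G j) = B *\<^sub>v x"] col by blast
  define C where "C = mat s (card K) (\<lambda>(i,j). x (pick K j) $ i)"
  have C: "C \<in> carrier_mat s (card K)" by (simp add: C_def)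
  have "map_mat rat_of_int ?S = B * C"
  proof (rule eq_matI)
    fix i j assume "i < dim_row (B * C)" "j < dim_col (B * C)"
    then have ij: "i < k" "j < card K" using B C by auto
    have pick: "pick K j \<in> K" by (rule pick_in_set_le[OF ij(2)])
    have "pick K j < n" using pick K by auto
    then have "map_mat rat_of_int ?S $$ (i,j) = map_vec rat_of_int (col G (pick K j)) $ i"
      using S G ij submatrix_cols_index[OF G K ij] by simp
    also have "\<dots> = (B *\<^sub>v x (pick K j)) $ i" using x[OF pick] by simp
    also have "x (pick K j) = col C j"
      using x[OF pick] ij by (intro eq_vecI) (auto simp: C_def)
    finally show "map_mat rat_of_int ?S $$ (i,j) = (B * C) $$ (i,j)" using B C ij by simp
  qed (use S B C in auto)
  then show ?thesis
    using vec_space.rank_mult_le[OF B C] S unfolding col_rank_def int_rank_def by simp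
qed

text \<open>Converse to \<open>col_rank_leI\<close>: a rank factorization of the submatrix provides
  a family of exactly r(K) rational vectors that spans the columns in K.\<close>

lemma col_rank_basis:
  assumes K: "K \<subseteq> E"
  obtains B where "B \<in> carrier_mat k (col_rank G K)"
    "\<And>j. j \<in> K \<Longrightarrow> \<exists>x \<in> carrier_vec (col_rank G K). map_vec rat_of_int (col G j) = B *\<^sub>v x"
proof -
  let ?S = "submatrix G UNIV K"
  have S: "?S \<in> carrier_mat k (card K)" by (rule submatrix_cols_carrier[OF G K])
  have rk: "vec_space.rank k (map_mat rat_of_int ?S) = col_rank G K"
    using S unfolding col_rank_def int_rank_def by simp
  have hS: "map_mat rat_of_int ?S \<in> carrier_mat k (card K)" using S by simp
  obtain B C where BC: "B \<in> carrier_mat k (col_rank G K)" "C \<in> carrier_mat (col_rank G K) (card K)"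
    "map_mat rat_of_int ?S = B * C"
    using vec_space.rank_factorization[OF hS] unfolding rk .
  have "\<exists>x \<in> carrier_vec (col_rank G K). map_vec rat_of_int (col G j) = B *\<^sub>v x" if j: "j \<in> K" for j
  proof -
    have "j \<in> pick K ` {..<card K}" using pick_image[OF K] j by simp
    then obtain l where l: "l < card K" "j = pick K l" by auto
    have jn: "j < n" using j K by auto
    have "col C l \<in> carrier_vec (col_rank G K)" using BC(2) l by (intro col_carrier_vec) auto
    moreover have "map_vec rat_of_int (col G j) = B *\<^sub>v col C l"
    proof (rule eq_vecI)
      fix i assume "i < dim_vec (B *\<^sub>v col C l)"
      then have i: "i < k" using BC(1) by simp
      have "map_vec rat_of_int (col G j) $ i = map_mat rat_of_int ?S $$ (i,l)"
        using S G i l jn submatrix_cols_index[OF G K i l(1)] by simp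
      also have "\<dots> = (B *\<^sub>v col C l) $ i" unfolding BC(3) using BC(1,2) i l by simp
      finally show "map_vec rat_of_int (col G j) $ i = (B *\<^sub>v col C l) $ i" .
    qed (use BC(1) G in simp)
    ultimately show ?thesis by (intro bexI[of _ "col C l"])
  qed
  then show ?thesis using BC(1) by (intro that[of B])
qed

lemma col_rank_insert_le:
  assumes J: "J \<subseteq> E" and j: "j \<in> E"
  shows "col_rank G (insert j J) \<le> Suc (col_rank G J)"
proof -
  let ?s = "col_rank G J"
  obtain B where B: "B \<in> carrier_mat k ?s"
    "\<And>i. i \<in> J \<Longrightarrow> \<exists>x \<in> carrier_vec ?s. map_vec rat_of_int (col G i) = B *\<^sub>v x"
    by (rule col_rank_basis[OF J]) (rule that)
  \<comment> \<open>The new column of G is appended to the family spanning the columns in J.\<close>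
  define B' where "B' = mat k (Suc ?s) (\<lambda>(i,l). if l < ?s then B $$ (i,l) else rat_of_int (G $$ (i,j)))"
  have B': "B' \<in> carrier_mat k (Suc ?s)" by (simp add: B'_def)
  have mult: "(B' *\<^sub>v v) $ i = (\<Sum>l<?s. B $$ (i,l) * v $ l) + rat_of_int (G $$ (i,j)) * v $ ?s"
    if "i < k" "v \<in> carrier_vec (Suc ?s)" for i v
    using that B' by (simp add: scalar_prod_def B'_def atLeast0LessThan)
  show ?thesis
  proof (rule col_rank_leI[OF _ B'])
    show "insert j J \<subseteq> E" using J j by simp
    fix i assume i: "i \<in> insert j J"
    show "\<exists>x \<in> carrier_vec (Suc ?s). map_vec rat_of_int (col G i) = B' *\<^sub>v x"
    proof (cases "i \<in> J")
      case True
      then obtain x where x: "x \<in> carrier_vec ?s" "map_vec rat_of_int (col G i) = B *\<^sub>v x" using B(2) by blast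
      let ?y = "vec (Suc ?s) (\<lambda>l. if l < ?s then x $ l else 0)"
      have "B *\<^sub>v x = B' *\<^sub>v ?y"
      proof (rule eq_vecI)
        fix a assume "a < dim_vec (B' *\<^sub>v ?y)"
        then have a: "a < k" using B' by simp
        have "(B *\<^sub>v x) $ a = (\<Sum>l<?s. B $$ (a,l) * x $ l)"
          using a B(1) x(1) by (simp add: scalar_prod_def atLeast0LessThan)
        then show "(B *\<^sub>v x) $ a = (B' *\<^sub>v ?y) $ a" using mult[OF a, of ?y] by simp
      qed (use B(1) B' in simp)
      then show ?thesis using x(2) by (intro bexI[of _ ?y]) auto
    next
      case False
      then have ij: "i = j" using i by simp
      let ?y = "vec (Suc ?s) (\<lambda>l. if l < ?s then 0 else 1 :: rat)"
      have "map_vec rat_of_int (col G i) = B' *\<^sub>v ?y"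
      proof (rule eq_vecI)
        fix a assume "a < dim_vec (B' *\<^sub>v ?y)"
        then have a: "a < k" using B' by simp
        then show "map_vec rat_of_int (col G i) $ a = (B' *\<^sub>v ?y) $ a"
          using mult[OF a, of ?y] G j ij by simp
      qed (use G B' in simp)
      then show ?thesis by (intro bexI[of _ ?y]) auto
    qed
  qed
qed

lemma col_rank_E_pos:
  assumes "j < n" "col G j \<noteq> 0\<^sub>v k"
  shows "0 < col_rank G E"
proof (rule ccontr)
  assume "\<not> 0 < col_rank G E"
  then have "divisors E = []" using length_divisors[OF order_refl] by simp
  then have "smith_equiv k n G (smith_diag k n [])" using divisors_E unfolding smith_form_def by simp
  then have eq: "smith_equiv k n (smith_diag k n []) G" by (rule smith_equiv_sym)
  \<comment> \<open>In rank 0 the diagonal form is zero, so 0 divides all entries of every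
    equivalent matrix.\<close>
  have "0 dvd G $$ (i,j)" if i: "i < k" for i
    by (rule smith_equiv_dvd_entries[OF eq _ i assms(1)]) (simp add: smith_diag_index)
  then have "col G j = 0\<^sub>v k" using G assms(1) by (intro eq_vecI) auto
  then show False using assms(2) by simp
qed

end

section \<open>The minimum weight\<close>

lemma Inf_enat_in:
  fixes A :: "enat set"
  assumes "A \<noteq> {}"
  shows "Inf A \<in> A"
proof -
  obtain x where "x \<in> A" using assms by blast
  then have "(LEAST x. x \<in> A) \<in> A" by (rule LeastI)
  then show ?thesis using assms by (simp add: Inf_enat_def)
qed

text \<open>The absence of zero columns enters as \<open>rank_pos\<close>, which guarantees that the
  minimum defining \<open>poly_min_weight\<close> exists.\<close>

locale divisor_code = integer_code +
  fixes m :: nat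
  assumes m_pos: "0 < m" and m_dvd: "m dvd lcm_period G" and period_pos: "0 < lcm_period G"
    and n_pos: "0 < n" and rank_pos: "0 < col_rank G E"
begin

section \<open>Polynomial identities from the admissible moduli\<close>

abbreviation "admissible q \<equiv> 0 < q \<and> gcd q (lcm_period G) = m"

abbreviation "d \<equiv> poly_min_weight G m"

lemma admissible_m: "admissible m"
  using m_pos m_dvd by (simp add: gcd_nat.absorb1)

lemma infinite_admissible: "infinite {q. admissible q}"
proof
  assume fin: "finite {q. admissible q}"
  \<comment> \<open>Adding multiples of the period to m does not change the gcd with the
    period.\<close>
  have "range (\<lambda>t. m + t * lcm_period G) \<subseteq> {q. admissible q}"
  proof (intro image_subsetI CollectI conjI)
    fix t
    show "gcd (m + t * lcm_period G) (lcm_period G) = m"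
      using admissible_m gcd_add_mult[of "lcm_period G" t m] by (simp add: gcd.commute add.commute)
  qed (use m_pos in simp)
  moreover have "inj (\<lambda>t. m + t * lcm_period G)" using period_pos by (simp add: inj_on_def)
  ultimately have "finite (UNIV :: nat set)" using finite_subset[OF _ fin] finite_imageD by blast
  then show False by simp
qed

lemma poly_eqI_admissible:
  fixes p p' :: "rat poly"
  assumes "\<And>q. admissible q \<Longrightarrow> poly p (of_nat q) = poly p' (of_nat q)"
  shows "p = p'"
proof (rule ccontr)
  assume "p \<noteq> p'"
  then have "finite {x. poly (p - p') x = 0}" by (intro poly_roots_finite) simp
  moreover have "rat_of_nat ` {q. admissible q} \<subseteq> {x. poly (p - p') x = 0}" using assms by auto
  ultimately have "finite (rat_of_nat ` {q. admissible q})" by (rule finite_subset[rotated])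
  then show False using infinite_admissible by (simp add: finite_image_iff inj_on_def)
qed

lemma poly_cell:
  "admissible q \<Longrightarrow> poly (cell_poly m J) (of_nat q) = of_nat (card (exact q J))"
  by (rule poly_cell_poly) simp_all

lemma ratio_admissible:
  assumes "admissible q" "K \<subseteq> E"
  shows "ratio q K = ratio m K"
  using gcd_prod_gcd[OF assms(2), of q] gcd_prod_gcd[OF order_refl, of q] assms(1) unfolding ratio_def by simp

lemma ratio_pos: "0 < ratio m K"
  unfolding ratio_def using gcd_prod_pos[OF m_pos] by simp

text \<open>At each admissible q both sides count the codewords vanishing on J, sorted on the left
  by their exact zero sets. Infinitely many values determine the polynomial.\<close>

lemma sum_cell_poly:
  assumes J: "J \<subseteq> E"
  shows "(\<Sum>K\<in>{K. J \<subseteq> K \<and> K \<subseteq> E}. cell_poly m K) = monom (ratio m J) (col_rank G E - col_rank G J)"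
proof (rule poly_eqI_admissible)
  fix q assume q: "admissible q"
  then have q0: "0 < q" by simp
  have "poly (\<Sum>K\<in>{K. J \<subseteq> K \<and> K \<subseteq> E}. cell_poly m K) (of_nat q) = rat_of_nat (card (vanishing q J))"
    unfolding poly_sum card_vanishing_eq_sum[OF q0] of_nat_sum by (intro sum.cong) (simp_all add: poly_cell[OF q])
  then show "poly (\<Sum>K\<in>{K. J \<subseteq> K \<and> K \<subseteq> E}. cell_poly m K) (of_nat q) =
      poly (monom (ratio m J) (col_rank G E - col_rank G J)) (of_nat q)"
    unfolding card_vanishing[OF J q0] poly_monom ratio_admissible[OF q J] .
qed

text \<open>The constant 1 stands for the zero codeword, the only one that vanishes
  everywhere.\<close>

lemma cell_poly_E: "cell_poly m E = 1"
proof -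
  have "{K. E \<subseteq> K \<and> K \<subseteq> E} = {E}" by auto
  then have "cell_poly m E = monom (ratio m E) 0" using sum_cell_poly[OF order_refl] by simp
  moreover have "ratio m E = 1" unfolding ratio_def using gcd_prod_pos[OF m_pos, of E] by simp
  ultimately show ?thesis by (simp add: monom_0 one_pCons)
qed

text \<open>A sum of counting polynomials vanishes only if every summand does, because all their values
  at admissible moduli are nonnegative.\<close>

lemma cell_poly_eq_0:
  assumes "weight_poly G m i = 0" and J: "J \<subseteq> E" "card J = n - i"
  shows "cell_poly m J = 0"
proof (rule poly_eqI_admissible)
  fix q assume q: "admissible q"
  let ?I = "{J. J \<subseteq> E \<and> card J = n - i}"
  have fin: "finite ?I" by (rule finite_subset[of _ "Pow E"]) auto
  have "(\<Sum>J\<in>?I. rat_of_nat (card (exact q J))) = poly (weight_poly G m i) (of_nat q)"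
    unfolding weight_poly_eq poly_sum by (intro sum.cong) (simp_all add: poly_cell[OF q])
  then have "(\<Sum>J\<in>?I. rat_of_nat (card (exact q J))) = 0" using assms(1) by simp
  then have "rat_of_nat (card (exact q J)) = 0"
    using sum_nonneg_eq_0_iff[OF fin, of "\<lambda>J. rat_of_nat (card (exact q J))"] J by simp
  then show "poly (cell_poly m J) (of_nat q) = poly 0 (of_nat q)" using poly_cell[OF q] by simp
qed

text \<open>If all weight polynomials of positive index vanished, only the cell of E would survive
  in the sum over all subsets, which would then be 1. But this sum is a monomial of degree r(E), and
  r(E) is positive.\<close>

lemma poly_min_weight_props: "0 < d \<and> d \<le> n \<and> weight_poly G m d \<noteq> 0"
proof -
  have dim: "dim_col G = n" using G by simp
  have "\<exists>i. 0 < i \<and> i \<le> n \<and> weight_poly G m i \<noteq> 0"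
  proof (rule ccontr)
    assume "\<nexists>i. 0 < i \<and> i \<le> n \<and> weight_poly G m i \<noteq> 0"
    then have zero: "weight_poly G m i = 0" if "0 < i" "i \<le> n" for i using that by blast
    have "cell_poly m K = 0" if K: "K \<subseteq> E" "K \<noteq> E" for K
    proof (rule cell_poly_eq_0[OF _ K(1)])
      have "card K < n" using psubset_card_mono[of E K] K by auto
      then show "weight_poly G m (n - card K) = 0" "card K = n - (n - card K)" using zero by simp_all
    qed
    then have "(\<Sum>K\<in>{K. {} \<subseteq> K \<and> K \<subseteq> E}. cell_poly m K) = (\<Sum>K\<in>{E}. cell_poly m K)"
      using finite_interval by (intro sum.mono_neutral_right) auto
    then have "monom (ratio m {}) (col_rank G E - col_rank G {}) = 1"
      using sum_cell_poly[of "{}"] cell_poly_E by simp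
    then have "degree (monom (ratio m {}) (col_rank G E - col_rank G {})) = 0" by simp
    then have "col_rank G E \<le> col_rank G {}" using ratio_pos[of "{}"] by (simp add: degree_monom_eq)
    then show False using rank_pos col_rank_le(2)[of "{}"] by simp
  qed
  then show ?thesis unfolding poly_min_weight_def dim by (rule LeastI_ex)
qed

text \<open>The index \<open>n - card J\<close> is below d, and it is positive because J is a proper
  subset, so minimality of d applies.\<close>

lemma cell_poly_large:
  assumes J: "J \<subseteq> E" "n - d < card J" "J \<noteq> E"
  shows "cell_poly m J = 0"
proof (rule cell_poly_eq_0[OF _ J(1)])
  have lt: "card J < n" using psubset_card_mono[of E J] J by auto
  then show "card J = n - (n - card J)" by simp
  show "weight_poly G m (n - card J) = 0"
  proof (rule ccontr)
    assume "weight_poly G m (n - card J) \<noteq> 0"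
    then have "d \<le> n - card J"
      unfolding poly_min_weight_def using lt G by (intro Least_le) auto
    then show False using J(2) poly_min_weight_props lt by simp
  qed
qed

lemma cell_poly_minimal:
  assumes J: "J \<subseteq> E" "card J = n - d"
  shows "cell_poly m J = monom (ratio m J) (col_rank G E - col_rank G J) - 1"
proof -
  have JE: "J \<noteq> E" using J poly_min_weight_props n_pos by auto
  have "(\<Sum>K\<in>{K. J \<subseteq> K \<and> K \<subseteq> E}. cell_poly m K) = (\<Sum>K\<in>{J, E}. cell_poly m K)"
  proof (rule sum.mono_neutral_right[OF finite_interval])
    show "\<forall>K\<in>{K. J \<subseteq> K \<and> K \<subseteq> E} - {J, E}. cell_poly m K = 0"
    proof
      fix K assume K: "K \<in> {K. J \<subseteq> K \<and> K \<subseteq> E} - {J, E}"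
      then have "card J < card K" by (intro psubset_card_mono) (auto intro: finite_subset)
      then show "cell_poly m K = 0" using K J by (intro cell_poly_large) auto
    qed
  qed (use J in auto)
  also have "\<dots> = cell_poly m J + 1" using JE cell_poly_E by simp
  finally show ?thesis using sum_cell_poly[OF J(1)] by simp
qed

lemma card_exact_minimal:
  assumes q: "admissible q" and J: "J \<subseteq> E" "card J = n - d"
  shows "rat_of_nat (card (exact q J)) = ratio m J * of_nat q ^ (col_rank G E - col_rank G J) - 1"
  using poly_cell[OF q, of J] unfolding cell_poly_minimal[OF J] by (simp add: poly_monom)

text \<open>Adding one more column to \<^term>\<open>J\<close> already gives full rank: otherwise the counting polynomial
  of the larger set would have positive degree, contradicting the minimality of \<^term>\<open>d\<close>.\<close>

lemma col_rank_minimal: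
  assumes J: "J \<subseteq> E" "card J = n - d"
  shows "col_rank G E \<le> Suc (col_rank G J)"
proof -
  have "J \<noteq> E" using J poly_min_weight_props n_pos by auto
  then obtain j where j: "j \<in> E" "j \<notin> J" using J by blast
  let ?K = "insert j J"
  have K: "?K \<subseteq> E" using J j by auto
  have "finite J" using J finite_subset by blast
  then have cK: "n - d < card ?K" using J j by simp
  have "col_rank G E = col_rank G ?K"
  proof (cases "?K = E")
    case False
    have "(\<Sum>L\<in>{L. ?K \<subseteq> L \<and> L \<subseteq> E}. cell_poly m L) = (\<Sum>L\<in>{E}. cell_poly m L)"
    proof (rule sum.mono_neutral_right[OF finite_interval])
      show "\<forall>L\<in>{L. ?K \<subseteq> L \<and> L \<subseteq> E} - {E}. cell_poly m L = 0"
      proof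
        fix L assume L: "L \<in> {L. ?K \<subseteq> L \<and> L \<subseteq> E} - {E}"
        then have "card ?K \<le> card L" by (intro card_mono) (auto intro: finite_subset)
        then show "cell_poly m L = 0" using L cK by (intro cell_poly_large) auto
      qed
    qed (use K in auto)
    then have "monom (ratio m ?K) (col_rank G E - col_rank G ?K) = 1"
      using sum_cell_poly[OF K] cell_poly_E by simp
    then have "degree (monom (ratio m ?K) (col_rank G E - col_rank G ?K)) = 0" by simp
    then have "col_rank G E \<le> col_rank G ?K" using ratio_pos[of ?K] by (simp add: degree_monom_eq)
    then show ?thesis using col_rank_le_E[OF K] by simp
  qed simp
  then show ?thesis using col_rank_insert_le[OF J(1) j(1)] by simp
qed

section \<open>From zero sets to the minimum weight\<close>

lemma weight_eq:
  assumes "c \<in> carrier_vec n"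
  shows "weight c + card (zero_set c) = n"
proof -
  let ?N = "{j. j < dim_vec c \<and> c $ j \<noteq> 0}"
  have un: "?N \<union> zero_set c = E" using carrier_vecD[OF assms] unfolding zero_set_def by auto
  have "card (?N \<union> zero_set c) = card ?N + card (zero_set c)"
    by (intro card_Un_disjoint) (auto simp: zero_set_def)
  then show ?thesis unfolding un weight_def by simp
qed

lemma zero_set_eq_E_iff:
  assumes "c \<in> carrier_vec n"
  shows "zero_set c = E \<longleftrightarrow> c = 0\<^sub>v n"
proof
  assume "zero_set c = E"
  then have "c $ j = 0" if "j < n" for j using that unfolding zero_set_def by (auto simp: set_eq_iff)
  then show "c = 0\<^sub>v n" using assms by (intro eq_vecI) auto
qed (auto simp: zero_set_def)

text \<open>A nonzero codeword of smaller weight would have a zero set covered by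
  \<open>cell_poly_large\<close>, so the number of codewords with that zero set would be 0.\<close>

lemma weight_ge:
  assumes q: "admissible q" and c: "c \<in> code G q" "c \<noteq> 0\<^sub>v n"
  shows "d \<le> weight c"
proof (rule ccontr)
  assume lt: "\<not> d \<le> weight c"
  have cc: "c \<in> carrier_vec n" by (rule code_carrier[OF c(1)])
  have "n - d < card (zero_set c)" using weight_eq[OF cc] lt poly_min_weight_props by linarith
  then have "cell_poly m (zero_set c) = 0"
    using zero_set_eq_E_iff[OF cc] c(2) by (intro cell_poly_large[OF zero_set_subset]) auto
  then have "card (exact q (zero_set c)) = 0" using poly_cell[OF q, of "zero_set c"] by simp
  moreover have "finite (exact q (zero_set c))" using finite_code q unfolding exact_def by simp
  moreover have "c \<in> exact q (zero_set c)" using c unfolding exact_def by simp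
  ultimately show False by auto
qed

lemma min_weight_eq_iff:
  assumes q: "admissible q"
  shows "min_weight G q = enat d \<longleftrightarrow> (\<exists>J. J \<subseteq> E \<and> card J = n - d \<and> card (exact q J) \<noteq> 0)"
proof -
  let ?W = "{enat (weight c) | c. c \<in> code G q \<and> c \<noteq> 0\<^sub>v n}"
  have mw: "min_weight G q = Inf ?W" unfolding min_weight_def using G by simp
  have lower: "enat d \<le> w" if "w \<in> ?W" for w using that weight_ge[OF q] by auto
  show ?thesis
  proof
    assume "min_weight G q = enat d"
    then have inf: "Inf ?W = enat d" using mw by simp
    \<comment> \<open>For a code without nonzero words the infimum is infinite and cannot equal
      \<open>enat d\<close>.\<close>
    have "?W \<noteq> {}"
    proof
      assume empty: "?W = {}"
      show False using inf unfolding empty by (simp add: Inf_enat_def)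
    qed
    then have "Inf ?W \<in> ?W" by (rule Inf_enat_in)
    then obtain c where c: "c \<in> code G q" "c \<noteq> 0\<^sub>v n" "weight c = d" using inf by auto
    have "card (zero_set c) = n - d" using weight_eq[OF code_carrier[OF c(1)]] c(3) by simp
    moreover have "c \<in> exact q (zero_set c)" using c unfolding exact_def by simp
    moreover have "finite (exact q (zero_set c))" using finite_code q unfolding exact_def by simp
    ultimately show "\<exists>J. J \<subseteq> E \<and> card J = n - d \<and> card (exact q J) \<noteq> 0"
      using zero_set_subset by (intro exI[of _ "zero_set c"]) auto
  next
    assume "\<exists>J. J \<subseteq> E \<and> card J = n - d \<and> card (exact q J) \<noteq> 0"
    then obtain J where J: "J \<subseteq> E" "card J = n - d" "card (exact q J) \<noteq> 0" by blast
    then have "exact q J \<noteq> {}" by auto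
    then obtain c where c: "c \<in> code G q" "zero_set c = J" unfolding exact_def by blast
    have cc: "c \<in> carrier_vec n" by (rule code_carrier[OF c(1)])
    have "weight c = d"
      using weight_eq[OF cc, unfolded c(2) J(2)] poly_min_weight_props by linarith
    moreover have "J \<noteq> E" using J poly_min_weight_props n_pos by auto
    then have "c \<noteq> 0\<^sub>v n" unfolding zero_set_eq_E_iff[OF cc, symmetric] c(2) .
    ultimately have "enat d \<in> ?W" using c(1) by (intro CollectI exI[of _ c]) simp
    then show "min_weight G q = enat d"
      unfolding mw by (intro antisym Inf_lower Inf_greatest lower)
  qed
qed

lemma min_weight_large:
  assumes q: "admissible q" and mq: "m < q"
  shows "min_weight G q = enat d"
proof -
  have "\<exists>J. J \<subseteq> E \<and> card J = n - d \<and> cell_poly m J \<noteq> 0"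
  proof (rule ccontr)
    assume "\<nexists>J. J \<subseteq> E \<and> card J = n - d \<and> cell_poly m J \<noteq> 0"
    then have "weight_poly G m d = 0" unfolding weight_poly_eq by (intro sum.neutral) blast
    then show False using poly_min_weight_props by simp
  qed
  then obtain J where J: "J \<subseteq> E" "card J = n - d" and nz: "cell_poly m J \<noteq> 0" by blast
  let ?s = "col_rank G E - col_rank G J"
  have "card (exact q J) \<noteq> 0"
  proof (cases "?s = 0")
    \<comment> \<open>With equal ranks the polynomial is constant, so being nonzero as a polynomial
      it is nonzero at q.\<close>
    case True
    then have "monom (ratio m J) ?s - 1 = [:ratio m J - 1:]" by (simp add: monom_0 one_pCons)
    then have "ratio m J - 1 \<noteq> 0" using nz unfolding cell_poly_minimal[OF J] by (metis pCons_0_0)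
    then have "rat_of_nat (card (exact q J)) \<noteq> 0" unfolding card_exact_minimal[OF q J] True by simp
    then show ?thesis by simp
  next
    case False
    \<comment> \<open>At the admissible modulus m the value is a cardinality, hence nonnegative;
      strict growth makes it positive at q.\<close>
    have "0 \<le> ratio m J * of_nat m ^ ?s - 1"
      using card_exact_minimal[OF admissible_m J] by (metis of_nat_0_le_iff)
    also have "\<dots> < ratio m J * of_nat q ^ ?s - 1"
      using ratio_pos[of J] mq False by (simp add: power_strict_mono)
    also have "\<dots> = rat_of_nat (card (exact q J))" using card_exact_minimal[OF q J] by simp
    finally show ?thesis by simp
  qed
  then show ?thesis using J min_weight_eq_iff[OF q] by blast
qed

lemma exact_nonempty_iff:
  assumes J: "J \<subseteq> E" "card J = n - d"
  shows "card (exact m J) \<noteq> 0 \<longleftrightarrow>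
    rat_of_nat (\<Prod>l = 1..col_rank G J. gcd m (elem_div G J l)) /
      rat_of_nat (\<Prod>l = 1..col_rank G J. gcd m (elem_div G E l)) \<noteq> 1 \<or>
    (col_rank G E = col_rank G J + 1 \<and> \<not> m dvd elem_div G E (col_rank G J + 1))"
proof -
  let ?s = "col_rank G J"
  define a where "a = (\<Prod>l = 1..?s. gcd m (elem_div G J l))"
  define b where "b = (\<Prod>l = 1..?s. gcd m (elem_div G E l))"
  have b_pos: "0 < b" unfolding b_def using m_pos by (intro prod_pos) simp
  have "b \<le> a" unfolding a_def b_def
  proof (rule prod_mono, intro conjI)
    fix l assume l: "l \<in> {1..?s}"
    have "gcd m (elem_div G E l) dvd gcd m (elem_div G J l)"
      using elem_div_E_dvd[OF J(1) l] by (meson dvd_trans gcd_dvd1 gcd_dvd2 gcd_greatest)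
    then show "gcd m (elem_div G E l) \<le> gcd m (elem_div G J l)"
      using m_pos by (intro dvd_imp_le) simp_all
  qed simp
  then have ab: "1 \<le> rat_of_nat a / of_nat b" using b_pos by simp
  have card: "card (exact m J) \<noteq> 0 \<longleftrightarrow> ratio m J * of_nat m ^ (col_rank G E - ?s) \<noteq> 1"
  proof -
    have "card (exact m J) \<noteq> 0 \<longleftrightarrow> rat_of_nat (card (exact m J)) \<noteq> 0" by simp
    then show ?thesis unfolding card_exact_minimal[OF admissible_m J] by simp
  qed
  have "col_rank G E = ?s \<or> col_rank G E = ?s + 1"
    using col_rank_minimal[OF J] col_rank_le_E[OF J(1)] by linarith
  then show ?thesis
  proof
    assume r: "col_rank G E = ?s"
    then have "ratio m J = rat_of_nat a / of_nat b" unfolding ratio_def gcd_prod_def a_def b_def by simp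
    then show ?thesis unfolding card a_def[symmetric] b_def[symmetric] r by simp
  next
    assume r: "col_rank G E = ?s + 1"
    define e where "e = elem_div G E (?s + 1)"
    have "gcd_prod m E = b * gcd m e"
      unfolding gcd_prod_def b_def e_def r by simp
    \<comment> \<open>In this case the denominator of the ratio has one gcd factor more than its
      numerator. Paired with the single power of m, it gives the second factor, which is 1 exactly
      if m divides the last elementary divisor of G.\<close>
    then have ratio: "ratio m J * of_nat m ^ (col_rank G E - ?s) = (rat_of_nat a / of_nat b) * (of_nat m / of_nat (gcd m e))"
      unfolding ratio_def gcd_prod_def a_def r by simp
    have g: "0 < gcd m e" "gcd m e \<le> m" using m_pos by (simp_all add: gcd_le1_nat)
    then have x: "1 \<le> rat_of_nat m / of_nat (gcd m e)" by simp
    have x1: "rat_of_nat m / of_nat (gcd m e) = 1 \<longleftrightarrow> m dvd e"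
    proof -
      have "rat_of_nat m / of_nat (gcd m e) = 1 \<longleftrightarrow> rat_of_nat m = of_nat (gcd m e)"
        using g(1) by (simp only: divide_eq_1_iff of_nat_eq_0_iff) auto
      also have "\<dots> \<longleftrightarrow> gcd m e = m" by (metis of_nat_eq_iff)
      finally show ?thesis unfolding gcd_nat.absorb_iff1 .
    qed
    have prod: "u * v \<noteq> 1 \<longleftrightarrow> u \<noteq> 1 \<or> v \<noteq> 1" if "1 \<le> u" "1 \<le> v" for u v :: rat
    proof -
      have "u * 1 \<le> u * v" "1 * v \<le> u * v"
        using that by (intro mult_left_mono mult_right_mono; simp)+
      then show ?thesis using that by (cases "u * v = 1") auto
    qed
    show ?thesis
      unfolding card ratio prod[OF ab x] x1 a_def[symmetric] b_def[symmetric] e_def[symmetric] using r by simp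
  qed
qed

end

theorem theorem3p14:
  fixes G :: "int mat" and k n m :: nat
  assumes "G \<in> carrier_mat k n"
    and "0 < n"
    and "\<forall>j<n. col G j \<noteq> 0\<^sub>v k"
    and "m \<in> {1..lcm_period G}"
    and "m dvd lcm_period G"
  shows "(\<forall>q::nat. 0 < q \<and> m < q \<and> gcd q (lcm_period G) = m \<longrightarrow>
            min_weight G q = enat (poly_min_weight G m)) \<and>
         (min_weight G m = enat (poly_min_weight G m) \<longleftrightarrow>
           (\<exists>J \<subseteq> ground G. card J = n - poly_min_weight G m \<and>
             (rat_of_nat (\<Prod>l = 1..col_rank G J. gcd m (elem_div G J l)) /
                rat_of_nat (\<Prod>l = 1..col_rank G J. gcd m (elem_div G (ground G) l)) \<noteq> 1 \<or>
              (col_rank G (ground G) = col_rank G J + 1 \<and>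
                \<not> m dvd elem_div G (ground G) (col_rank G J + 1)))))"
proof -
  interpret integer_code G k n by unfold_locales (rule assms(1))
  \<comment> \<open>Positive rank comes from column 0, which exists as n is positive; the range of m
    makes the period positive.\<close>
  interpret divisor_code G k n m
    using assms(2-5) col_rank_E_pos[of 0] by unfold_locales auto
  have "min_weight G q = enat d" if "0 < q \<and> m < q \<and> gcd q (lcm_period G) = m" for q
    using that by (intro min_weight_large) simp_all
  moreover have "min_weight G m = enat d \<longleftrightarrow> (\<exists>J \<subseteq> E. card J = n - d \<and>
             (rat_of_nat (\<Prod>l = 1..col_rank G J. gcd m (elem_div G J l)) /
                rat_of_nat (\<Prod>l = 1..col_rank G J. gcd m (elem_div G E l)) \<noteq> 1 \<or>
              (col_rank G E = col_rank G J + 1 \<and>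
                \<not> m dvd elem_div G E (col_rank G J + 1))))"
    unfolding min_weight_eq_iff[OF admissible_m] using exact_nonempty_iff by blast
  ultimately show ?thesis unfolding ground_eq by blast
qed

end
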